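(* $\mathrm{mdim}_{\mathbb{C}}(G_2)=8$ and $\mathrm{mdim}_{\mathbb{R}}(G_2)=16$. Moreover, a faithful real representation of $G_2$ of minimal dimension $16$ may be obtained by restriction of scalars from a faithful complex representation of $G_2$.
   Context: The $2\times2\times2$ Rubik's cube consists of 8 corner cubelets, each carrying 3 colored stickers (24 stickers in all). Corner positions are numbered 1 = top-front-left, 2 = top-front-right, 3 = top-back-left, 4 = top-back-right, 5 = bottom-front-left, 6 = bottom-front-right, 7 = bottom-back-left, 8 = bottom-back-right. $G_2$ is the subgroup of the symmetric group on the 24 stickers generated by the six moves $u,d,f,b,l,r$, which rotate respectively the top, bottom, front, back, left, right layer of four cubelets by $90^\circ$ clockwise as seen by an observer outside the cube facing that face, leaving the other four cubelets fixed. For a finite group $G$ and field $F$, $\mathrm{mdim}_F(G)$ is the smallest dimension of a faithful representation of $G$ over $F$. *)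

theory Defs
  imports "HOL-Algebra.Bij" "HOL-Algebra.Generated_Groups" "Jordan_Normal_Form.Matrix" Complex_Main
begin

text \<open>Coordinates: x points right, y points back, z points up; the cube is
 [-1,1]^3 made of 8 corner cubelets. A corner position is a vector p in {-1,1}^3
 (e.g. position 1 = top-front-left = (-1,-1,1)). A sticker is a pair (p, v)
 where p is a corner position and v is the outward unit normal of one of the
 three faces of the cube touching that corner, i.e. v = p_i e_i. There are 24 stickers.\<close>

type_synonym vec3 = "int \<times> int \<times> int"
type_synonym sticker = "vec3 \<times> vec3"

definition corner_positions :: "vec3 set" where
  "corner_positions = {(a, b, c). a \<in> {-1, 1} \<and> b \<in> {-1, 1} \<and> c \<in> {-1, 1}}"

definition stickers :: "sticker set" where
  "stickers = {(p, v). p \<in> corner_positions \<and>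
      (case p of (a, b, c) \<Rightarrow> v \<in> {(a, 0, 0), (0, b, 0), (0, 0, c)})}"

fun dot3 :: "vec3 \<Rightarrow> vec3 \<Rightarrow> int" where
  "dot3 (a1, a2, a3) (b1, b2, b3) = a1 * b1 + a2 * b2 + a3 * b3"

fun cross3 :: "vec3 \<Rightarrow> vec3 \<Rightarrow> vec3" where
  "cross3 (a1, a2, a3) (b1, b2, b3) = (a2 * b3 - a3 * b2, a3 * b1 - a1 * b3, a1 * b2 - a2 * b1)"

fun scale3 :: "int \<Rightarrow> vec3 \<Rightarrow> vec3" where
  "scale3 k (a1, a2, a3) = (k * a1, k * a2, k * a3)"

fun diff3 :: "vec3 \<Rightarrow> vec3 \<Rightarrow> vec3" where
  "diff3 (a1, a2, a3) (b1, b2, b3) = (a1 - b1, a2 - b2, a3 - b3)"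

text \<open>Rotation by 90 degrees about the unit coordinate axis n, clockwise as seen
 by an observer outside the cube looking at the face with outward normal n
 (i.e. rotation by -90 degrees in the right-hand sense):
 x \<mapsto> (n.x) n - n \<times> x.\<close>

definition rot_cw :: "vec3 \<Rightarrow> vec3 \<Rightarrow> vec3" where
  "rot_cw n x = diff3 (scale3 (dot3 n x) n) (cross3 n x)"

text \<open>The face turn for the face with outward normal n, as a permutation of the
 24 stickers (an element of the HOL-Algebra bijection group on the sticker set,
 hence extensional): stickers on the four cubelets of that layer (n.p > 0) are
 rotated, all other stickers are fixed.\<close>

definition face_move :: "vec3 \<Rightarrow> sticker \<Rightarrow> sticker" where
  "face_move n = (\<lambda>s \<in> stickers. case s of (p, v) \<Rightarrow>
       if dot3 n p > 0 then (rot_cw n p, rot_cw n v) else (p, v))"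

definition move_u :: "sticker \<Rightarrow> sticker" where "move_u = face_move (0, 0, 1)"
definition move_d :: "sticker \<Rightarrow> sticker" where "move_d = face_move (0, 0, -1)"
definition move_f :: "sticker \<Rightarrow> sticker" where "move_f = face_move (0, -1, 0)"
definition move_b :: "sticker \<Rightarrow> sticker" where "move_b = face_move (0, 1, 0)"
definition move_l :: "sticker \<Rightarrow> sticker" where "move_l = face_move (-1, 0, 0)"
definition move_r :: "sticker \<Rightarrow> sticker" where "move_r = face_move (1, 0, 0)"

definition G2 :: "(sticker \<Rightarrow> sticker) monoid" where
  "G2 = (BijGroup stickers)
     \<lparr>carrier := generate (BijGroup stickers) {move_u, move_d, move_f, move_b, move_l, move_r}\<rparr>"

definition faithful_rep :: "('g, 'b) monoid_scheme \<Rightarrow> nat \<Rightarrow> ('g \<Rightarrow> 'a :: field mat) \<Rightarrow> bool" where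
  "faithful_rep G n \<rho> \<longleftrightarrow>
     (\<forall>g \<in> carrier G. \<rho> g \<in> carrier_mat n n \<and> invertible_mat (\<rho> g)) \<and>
     (\<forall>g \<in> carrier G. \<forall>h \<in> carrier G. \<rho> (g \<otimes>\<^bsub>G\<^esub> h) = \<rho> g * \<rho> h) \<and>
     inj_on \<rho> (carrier G)"

definition mdim :: "'a :: field itself \<Rightarrow> ('g, 'b) monoid_scheme \<Rightarrow> nat" where
  "mdim F G = (LEAST n. \<exists>\<rho> :: 'g \<Rightarrow> 'a mat. faithful_rep G n \<rho>)"

text \<open>Restriction of scalars from C to R: the complex n\<times>n matrix A = X + iY,
 viewed as an R-linear map of C^n = R^n \<oplus> R^n (real parts, then imaginary parts),
 has the real 2n\<times>2n matrix [[X, -Y], [Y, X]].\<close>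

definition realify :: "complex mat \<Rightarrow> real mat" where
  "realify A = four_block_mat (map_mat Re A) (map_mat (\<lambda>z. - Im z) A)
                              (map_mat Im A) (map_mat Re A)"

end

theory Submission
  imports Defs "HOL-Combinatorics.Permutations" "Jordan_Normal_Form.Spectral_Radius"
begin

text \<open>
  Numbering corners and the three stickers of each corner embeds \<open>G\<^sub>2\<close> into the wreath product of
  \<open>C\<^sub>3\<close> by \<open>S\<^sub>8\<close>. Monomial matrices with cube roots of unity as entries represent this wreath product
  faithfully in dimension 8, and restriction of scalars doubles the dimension.

  For the lower bounds, consider the abelian normal subgroup of pure twists in a faithful complex
  representation. As \<open>G\<^sub>2\<close> induces all permutations of the corners, the joint eigenvalues
  \<open>e : {0, \<dots>, 7} \<rightarrow> {1, \<omega>, \<omega>\<^sup>2}\<close> of the twists form an \<open>S\<^sub>8\<close>-invariant set, whose size is at most the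
  dimension. Faithfulness provides a nonconstant \<open>e\<close>, and one of its fibers has \<open>k\<close> elements with
  \<open>1 \<le> k \<le> 7\<close>, so that its orbit has at least \<open>8 choose k \<ge> 8\<close> elements. If the representation is real, the
  set is also closed under complex conjugation. Either some fiber has \<open>2 \<le> k \<le> 6\<close> elements and
  \<open>8 choose k \<ge> 28\<close>, or \<open>e\<close> takes a nonreal value exactly seven times, and the orbits of \<open>e\<close> and of its
  conjugate are disjoint.
\<close>

section \<open>Joint eigenvalues of commuting matrices\<close>

text \<open>Extensionality makes a member depend only on its values below \<open>m\<close>; without
  it the set could not be finite.\<close>

definition joint_spectrum :: "nat \<Rightarrow> nat \<Rightarrow> (nat \<Rightarrow> 'a :: field mat) \<Rightarrow> (nat \<Rightarrow> 'a) set" where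
  "joint_spectrum n m A = {e \<in> extensional {..<m}.
     \<exists>v \<in> carrier_vec n. v \<noteq> 0\<^sub>v n \<and> (\<forall>i<m. A i *\<^sub>v v = e i \<cdot>\<^sub>v v)}"

text \<open>The sum of \<open>x ^ i \<cdot>\<^sub>m A i\<close> over \<open>i < m\<close>. It is
  defined by recursion because matrices of all sizes share one type, so the zero to start from
  depends on \<open>n\<close>.\<close>

fun mat_poly_sum :: "nat \<Rightarrow> (nat \<Rightarrow> 'a :: field mat) \<Rightarrow> 'a \<Rightarrow> nat \<Rightarrow> 'a mat" where
  "mat_poly_sum n A x 0 = 0\<^sub>m n n"
| "mat_poly_sum n A x (Suc m) = mat_poly_sum n A x m + x ^ m \<cdot>\<^sub>m A m"

lemma mat_poly_sum_carrier [simp]: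
  "(\<And>i. i < m \<Longrightarrow> A i \<in> carrier_mat n n) \<Longrightarrow> mat_poly_sum n A x m \<in> carrier_mat n n"
  by (induction m) auto

lemma mat_poly_sum_mult_vec:
  assumes "\<And>i. i < m \<Longrightarrow> A i \<in> carrier_mat n n" "v \<in> carrier_vec n"
    and "\<And>i. i < m \<Longrightarrow> A i *\<^sub>v v = e i \<cdot>\<^sub>v v"
  shows "mat_poly_sum n A x m *\<^sub>v v = (\<Sum>i<m. x ^ i * e i) \<cdot>\<^sub>v v"
  using assms
proof (induction m)
  case 0
  then show ?case by (intro eq_vecI) auto
next
  case (Suc m)
  have A: "A m \<in> carrier_mat n n" "mat_poly_sum n A x m \<in> carrier_mat n n"
    using Suc.prems by auto
  have "mat_poly_sum n A x (Suc m) *\<^sub>v v = mat_poly_sum n A x m *\<^sub>v v + (x ^ m \<cdot>\<^sub>m A m) *\<^sub>v v"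
    using A Suc.prems(2) by (simp add: add_mult_distrib_mat_vec[of _ n n])
  also have "(x ^ m \<cdot>\<^sub>m A m) *\<^sub>v v = x ^ m \<cdot>\<^sub>v (e m \<cdot>\<^sub>v v)"
  proof -
    have "(x ^ m \<cdot>\<^sub>m A m) *\<^sub>v v = x ^ m \<cdot>\<^sub>v (A m *\<^sub>v v)"
      using A Suc.prems(2) by (intro eq_vecI) auto
    then show ?thesis
      using Suc.prems(3)[of m] by simp
  qed
  also have "mat_poly_sum n A x m *\<^sub>v v = (\<Sum>i<m. x ^ i * e i) \<cdot>\<^sub>v v"
    using Suc by simp
  finally show ?case
    using Suc.prems(2) by (simp add: smult_smult_assoc add_smult_distrib_vec)
qed

text \<open>A generic \<open>x\<close> turns distinct joint eigenvalues into distinct eigenvalues of one matrix.\<close>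

lemma ex_separating_point:
  fixes F :: "(nat \<Rightarrow> 'a :: field_char_0) set"
  assumes "finite F" "F \<subseteq> extensional {..<m}"
  obtains x where "inj_on (\<lambda>e. \<Sum>i<m. x ^ i * e i) F"
proof -
  define p where "p e e' = (\<Sum>i<m. monom (e i - e' i) i)" for e e' :: "nat \<Rightarrow> 'a"
  \<comment> \<open>\<open>R\<close> collects the bad points, the roots of finitely many nonzero
    difference polynomials. It is finite, and a field of characteristic 0 is infinite.\<close>
  define R where "R = (\<Union>(e, e') \<in> {z \<in> F \<times> F. fst z \<noteq> snd z}. {x. poly (p e e') x = 0})"
  have p: "p e e' \<noteq> 0" if ee: "e \<in> F" "e' \<in> F" "e \<noteq> e'" for e e'
  proof -
    obtain i where i: "i < m" "e i \<noteq> e' i"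
    proof (rule ccontr)
      assume "\<not> thesis"
      then have "e i = e' i" if "i < m" for i
        using that \<open>\<And>i. i < m \<Longrightarrow> e i \<noteq> e' i \<Longrightarrow> thesis\<close> by blast
      then have "e = e'"
        using ee assms(2) by (intro extensionalityI[of e "{..<m}" e']) auto
      then show False
        using \<open>e \<noteq> e'\<close> by simp
    qed
    have "coeff (p e e') i = (\<Sum>j<m. if j = i then e i - e' i else 0)"
      unfolding p_def coeff_sum by (rule sum.cong) auto
    then have "coeff (p e e') i \<noteq> 0"
      using i by simp
    then show ?thesis
      by auto
  qed
  have "finite R"
    unfolding R_def
  proof (rule finite_UN_I)
    show "finite {z \<in> F \<times> F. fst z \<noteq> snd z}"
      using assms(1) by simp
    show "finite (case z of (e, e') \<Rightarrow> {x. poly (p e e') x = 0})" if "z \<in> {z \<in> F \<times> F. fst z \<noteq> snd z}" for z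
      using that p by (auto intro!: poly_roots_finite)
  qed
  then obtain x where x: "x \<notin> R"
    using ex_new_if_finite infinite_UNIV_char_0 by blast
  have "inj_on (\<lambda>e. \<Sum>i<m. x ^ i * e i) F"
  proof (rule inj_onI, rule ccontr)
    fix e e'
    assume *: "e \<in> F" "e' \<in> F" "(\<Sum>i<m. x ^ i * e i) = (\<Sum>i<m. x ^ i * e' i)" "e \<noteq> e'"
    have "poly (p e e') x = (\<Sum>i<m. x ^ i * e i) - (\<Sum>i<m. x ^ i * e' i)"
      unfolding p_def by (simp add: poly_sum poly_monom sum_subtractf[symmetric] algebra_simps)
    then show False
      using * x unfolding R_def by auto
  qed
  then show thesis
    by (rule that)
qed

text \<open>A joint eigenvector is an eigenvector of \<open>mat_poly_sum n A x m\<close>. For a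
  separating \<open>x\<close>, joint eigenvalues thus inject into the spectrum of one
  \<open>n\<close> by \<open>n\<close> matrix, which has at most \<open>n\<close> elements.\<close>

lemma card_joint_spectrum:
  fixes A :: "nat \<Rightarrow> 'a :: field_char_0 mat"
  assumes A: "\<And>i. i < m \<Longrightarrow> A i \<in> carrier_mat n n"
  shows "finite (joint_spectrum n m A)" "card (joint_spectrum n m A) \<le> n"
proof -
  \<comment> \<open>A separating point exists only for finite sets. A uniform bound on all finite
    subsets yields finiteness and the bound together.\<close>
  have *: "card F \<le> n" if F: "F \<subseteq> joint_spectrum n m A" "finite F" for F
  proof -
    obtain x where inj: "inj_on (\<lambda>e. \<Sum>i<m. x ^ i * e i) F"
      using ex_separating_point[OF F(2), of m] F(1) unfolding joint_spectrum_def by blast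
    have M: "mat_poly_sum n A x m \<in> carrier_mat n n"
      using A by simp
    have "(\<lambda>e. \<Sum>i<m. x ^ i * e i) ` F \<subseteq> spectrum (mat_poly_sum n A x m)"
    proof
      fix k
      assume "k \<in> (\<lambda>e. \<Sum>i<m. x ^ i * e i) ` F"
      then obtain e v where k: "k = (\<Sum>i<m. x ^ i * e i)" and v: "v \<in> carrier_vec n" "v \<noteq> 0\<^sub>v n"
        "\<And>i. i < m \<Longrightarrow> A i *\<^sub>v v = e i \<cdot>\<^sub>v v"
        using F(1) unfolding joint_spectrum_def by blast
      then have "eigenvector (mat_poly_sum n A x m) v k"
        using mat_poly_sum_mult_vec[OF A v(1) v(3)] M unfolding eigenvector_def by simp
      then show "k \<in> spectrum (mat_poly_sum n A x m)"
        unfolding spectrum_def eigenvalue_def by blast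
    qed
    then have "card ((\<lambda>e. \<Sum>i<m. x ^ i * e i) ` F) \<le> n"
      using card_finite_spectrum[OF M] card_mono order_trans by blast
    then show ?thesis
      by (simp add: card_image[OF inj])
  qed
  show "finite (joint_spectrum n m A)" "card (joint_spectrum n m A) \<le> n"
    using finite_if_finite_subsets_card_bdd[of "joint_spectrum n m A" n] * by simp_all
qed

section \<open>Cube roots of unity and eigenvectors of matrices of order three\<close>

definition omega :: complex where "omega = Complex (-1 / 2) (sqrt 3 / 2)"

lemma omega_square: "omega\<^sup>2 = Complex (-1 / 2) (- sqrt 3 / 2)"
  by (simp add: omega_def power2_eq_square complex_eq_iff)

lemma omega_cube: "omega ^ 3 = 1"
  using omega_square by (simp add: power3_eq_cube power2_eq_square omega_def complex_eq_iff)

lemma omega_square_cube: "(omega\<^sup>2) ^ 3 = 1"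
  using power_mult[of omega 2 3] power_mult[of omega 3 2] omega_cube by simp

lemma omega_sum: "1 + omega + omega\<^sup>2 = 0"
  unfolding omega_square by (simp add: omega_def complex_eq_iff)

lemma omega_neq: "omega \<noteq> 1" "omega\<^sup>2 \<noteq> 1" "omega \<noteq> omega\<^sup>2" 
  unfolding omega_square by (simp_all add: omega_def complex_eq_iff)

text \<open>If \<open>B\<^sup>3 = 1\<close> and \<open>\<mu>\<^sup>3 = 1\<close>, this is three times the projection of \<open>w\<close> to the \<open>\<mu>\<close>-eigenspace of \<open>B\<close>;
  note \<open>\<mu>\<^sup>2 = 1 / \<mu>\<close>.\<close>

definition eigenpart :: "complex mat \<Rightarrow> complex \<Rightarrow> complex vec \<Rightarrow> complex vec" where
  "eigenpart B \<mu> w = w + (\<mu>\<^sup>2 \<cdot>\<^sub>v (B *\<^sub>v w) + \<mu> \<cdot>\<^sub>v (B *\<^sub>v (B *\<^sub>v w)))"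

lemma eigenpart_carrier [simp]:
  "B \<in> carrier_mat n n \<Longrightarrow> w \<in> carrier_vec n \<Longrightarrow> eigenpart B \<mu> w \<in> carrier_vec n"
  by (simp add: eigenpart_def)

lemma eigenpart_index:
  assumes "B \<in> carrier_mat n n" "w \<in> carrier_vec n" "j < n"
  shows "eigenpart B \<mu> w $ j = w $ j + (\<mu>\<^sup>2 * (B *\<^sub>v w) $ j + \<mu> * (B *\<^sub>v (B *\<^sub>v w)) $ j)"
proof -
  have "dim_vec w = n" "dim_vec (B *\<^sub>v w) = n" "dim_vec (B *\<^sub>v (B *\<^sub>v w)) = n"
    using assms by auto
  then show ?thesis
    using assms(3) unfolding eigenpart_def by (simp del: index_mult_mat_vec)
qed

lemma mult_mat_vec_lincomb:
  fixes A :: "'a :: field mat"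
  assumes "A \<in> carrier_mat n n" "x \<in> carrier_vec n" "y \<in> carrier_vec n" "z \<in> carrier_vec n"
  shows "A *\<^sub>v (x + (a \<cdot>\<^sub>v y + b \<cdot>\<^sub>v z)) = A *\<^sub>v x + (a \<cdot>\<^sub>v (A *\<^sub>v y) + b \<cdot>\<^sub>v (A *\<^sub>v z))"
proof -
  have "A *\<^sub>v (a \<cdot>\<^sub>v y) = a \<cdot>\<^sub>v (A *\<^sub>v y)" "A *\<^sub>v (b \<cdot>\<^sub>v z) = b \<cdot>\<^sub>v (A *\<^sub>v z)"
    by (rule mult_mat_vec[OF assms(1,3)], rule mult_mat_vec[OF assms(1,4)])
  then show ?thesis
    using assms by (simp add: mult_add_distrib_mat_vec[of _ n n])
qed

lemma cube_mult_vec: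
  fixes B :: "'a :: field mat"
  assumes "B \<in> carrier_mat n n" "w \<in> carrier_vec n" "B * B * B = 1\<^sub>m n"
  shows "B *\<^sub>v (B *\<^sub>v (B *\<^sub>v w)) = w"
proof -
  have "B *\<^sub>v (B *\<^sub>v (B *\<^sub>v w)) = (B * B * B) *\<^sub>v w"
    using assms(1,2) by (simp add: assoc_mult_mat_vec[of _ n n _ n])
  then show ?thesis
    unfolding assms(3) using assms(2) by simp
qed

text \<open>\<open>B\<close> shifts the vectors \<open>w\<close>, \<open>B w\<close>,
  \<open>B B w\<close> cyclically, and since \<open>\<mu> ^ 3 = 1\<close>, multiplication by
  \<open>\<mu>\<close> has the same effect on the coefficients.\<close>

lemma eigenpart_eigen:
  assumes B: "B \<in> carrier_mat n n" "B * B * B = 1\<^sub>m n" and w: "w \<in> carrier_vec n" and \<mu>: "\<mu> ^ 3 = 1"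
  shows "B *\<^sub>v eigenpart B \<mu> w = \<mu> \<cdot>\<^sub>v eigenpart B \<mu> w"
proof -
  let ?w = "B *\<^sub>v w" and ?u = "B *\<^sub>v (B *\<^sub>v w)"
  have c: "?w \<in> carrier_vec n" "?u \<in> carrier_vec n"
    using assms by auto
  have "B *\<^sub>v eigenpart B \<mu> w = ?w + (\<mu>\<^sup>2 \<cdot>\<^sub>v ?u + \<mu> \<cdot>\<^sub>v w)"
    unfolding eigenpart_def using B w c by (simp add: mult_mat_vec_lincomb cube_mult_vec)
  also have "\<dots> = \<mu> \<cdot>\<^sub>v eigenpart B \<mu> w"
  proof (rule eq_vecI)
    fix j
    assume "j < dim_vec (\<mu> \<cdot>\<^sub>v eigenpart B \<mu> w)"
    then have j: "j < n"
      using carrier_vecD[OF eigenpart_carrier[OF B(1) w]] by simp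
    have "\<mu> * \<mu>\<^sup>2 = 1"
      using \<mu> by (simp add: power3_eq_cube power2_eq_square mult.assoc)
    moreover have cyc: "m * (a + (m\<^sup>2 * b + m * c)) = b + (m\<^sup>2 * c + m * a)" if "m * m\<^sup>2 = 1" for a b c m :: complex
    proof -
      have "m * (a + (m\<^sup>2 * b + m * c)) = (m * m\<^sup>2) * b + (m\<^sup>2 * c + m * a)"
        by (simp add: algebra_simps power2_eq_square)
      then show ?thesis
        using that by simp
    qed
    ultimately have "\<mu> * (w $ j + (\<mu>\<^sup>2 * ?w $ j + \<mu> * ?u $ j)) = ?w $ j + (\<mu>\<^sup>2 * ?u $ j + \<mu> * w $ j)"
      using cyc by simp
    then show "(?w + (\<mu>\<^sup>2 \<cdot>\<^sub>v ?u + \<mu> \<cdot>\<^sub>v w)) $ j = (\<mu> \<cdot>\<^sub>v eigenpart B \<mu> w) $ j"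
      using j carrier_vecD[OF w] carrier_vecD[OF c(1)] carrier_vecD[OF c(2)] carrier_vecD[OF eigenpart_carrier[OF B(1) w]]
      by (simp add: eigenpart_index[OF B(1) w] del: index_mult_mat_vec dim_mult_mat_vec)
  qed (use w B c in \<open>auto simp: eigenpart_def\<close>)
  finally show ?thesis .
qed

text \<open>\<open>eigenpart B \<mu> w\<close> is a polynomial in \<open>B\<close> applied to
  \<open>w\<close>, and \<open>A\<close> commutes with such polynomials.\<close>

lemma eigenpart_commute:
  assumes "B \<in> carrier_mat n n" "A \<in> carrier_mat n n" "A * B = B * A" and w: "w \<in> carrier_vec n"
    and "A *\<^sub>v w = k \<cdot>\<^sub>v w"
  shows "A *\<^sub>v eigenpart B \<mu> w = k \<cdot>\<^sub>v eigenpart B \<mu> w"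
proof -
  have AB: "A *\<^sub>v (B *\<^sub>v x) = B *\<^sub>v (A *\<^sub>v x)" if "x \<in> carrier_vec n" for x
    using assms(1-3) that by (metis assoc_mult_mat_vec)
  have "A *\<^sub>v eigenpart B \<mu> w = k \<cdot>\<^sub>v w + (\<mu>\<^sup>2 \<cdot>\<^sub>v (k \<cdot>\<^sub>v (B *\<^sub>v w)) + \<mu> \<cdot>\<^sub>v (k \<cdot>\<^sub>v (B *\<^sub>v (B *\<^sub>v w))))"
    unfolding eigenpart_def using assms AB
    by (simp add: mult_mat_vec_lincomb[of _ n] mult_mat_vec[of _ n n])
  also have "\<dots> = k \<cdot>\<^sub>v eigenpart B \<mu> w"
    using assms by (intro eq_vecI) (auto simp: eigenpart_def algebra_simps)
  finally show ?thesis .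
qed

text \<open>The coefficients of \<open>B w\<close> and of \<open>B B w\<close> each add up to
  \<open>1 + omega + omega\<^sup>2 = 0\<close>. Up to the factor 3 this is the decomposition of
  \<open>w\<close> into eigenvectors.\<close>

lemma eigenpart_sum:
  assumes "B \<in> carrier_mat n n" "w \<in> carrier_vec n"
  shows "eigenpart B 1 w + eigenpart B omega w + eigenpart B (omega\<^sup>2) w = 3 \<cdot>\<^sub>v w"
proof (rule eq_vecI)
  fix j
  assume "j < dim_vec (3 \<cdot>\<^sub>v w)"
  then have j: "j < n"
    using assms by simp
  let ?b = "(B *\<^sub>v w) $ j" and ?c = "(B *\<^sub>v (B *\<^sub>v w)) $ j"
  have "(omega\<^sup>2)\<^sup>2 = omega"
    using omega_cube by (simp add: power2_eq_square power3_eq_cube mult.assoc)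
  moreover have "a + (b + c) + (a + (m\<^sup>2 * b + m * c)) + (a + (m * b + m\<^sup>2 * c)) = 3 * a" if "1 + m + m\<^sup>2 = 0" for a b c m :: complex
  proof -
    have "a + (b + c) + (a + (m\<^sup>2 * b + m * c)) + (a + (m * b + m\<^sup>2 * c)) = 3 * a + (1 + m + m\<^sup>2) * (b + c)"
      by (simp add: algebra_simps)
    then show ?thesis
      using that by simp
  qed
  ultimately have "(w $ j + (?b + ?c)) + (w $ j + (omega\<^sup>2 * ?b + omega * ?c)) + (w $ j + ((omega\<^sup>2)\<^sup>2 * ?b + omega\<^sup>2 * ?c)) = 3 * w $ j"
    using omega_sum by simp
  then show "(eigenpart B 1 w + eigenpart B omega w + eigenpart B (omega\<^sup>2) w) $ j = (3 \<cdot>\<^sub>v w) $ j"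
    using j carrier_vecD[OF assms(2)] carrier_vecD[OF eigenpart_carrier[OF assms]]
    by (simp add: eigenpart_index[OF assms] del: index_mult_mat_vec)
qed (use assms in \<open>auto simp: eigenpart_def\<close>)

lemma ex_eigenvector_cube:
  assumes B: "B \<in> carrier_mat n n" "B * B * B = 1\<^sub>m n" and w: "w \<in> carrier_vec n" "w \<noteq> 0\<^sub>v n"
  obtains \<mu> where "\<mu> ^ 3 = 1" "eigenpart B \<mu> w \<noteq> 0\<^sub>v n"
proof (rule ccontr)
  assume "\<not> thesis"
  then have z: "eigenpart B \<mu> w = 0\<^sub>v n" if "\<mu> ^ 3 = 1" for \<mu>
    using that \<open>\<And>\<mu>. \<mu> ^ 3 = 1 \<Longrightarrow> eigenpart B \<mu> w \<noteq> 0\<^sub>v n \<Longrightarrow> thesis\<close> by blast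
  have "3 \<cdot>\<^sub>v w = 0\<^sub>v n"
    using eigenpart_sum[OF B(1) w(1)] z omega_cube omega_square_cube by simp
  moreover have "(1 / 3) \<cdot>\<^sub>v (3 \<cdot>\<^sub>v w) = w"
    using w(1) by (simp add: smult_smult_assoc)
  moreover have "(1 / 3) \<cdot>\<^sub>v 0\<^sub>v n = (0\<^sub>v n :: complex vec)"
    by (intro eq_vecI) auto
  ultimately have "w = 0\<^sub>v n"
    by metis
  then show False
    using w by simp
qed

text \<open>Choose \<open>w\<close> not fixed by \<open>B\<close>. If its parts for
  \<open>omega\<close> and \<open>omega\<^sup>2\<close> both vanished, then
  \<open>3 \<cdot>\<^sub>v w\<close> would equal the part for 1, which \<open>B\<close>
  fixes.\<close>

lemma ex_nontrivial_eigenvector: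
  fixes B :: "complex mat"
  assumes B: "B \<in> carrier_mat n n" "B * B * B = 1\<^sub>m n" "B \<noteq> 1\<^sub>m n"
  obtains \<mu> w where "w \<in> carrier_vec n" "w \<noteq> 0\<^sub>v n" "\<mu> \<noteq> 1" "B *\<^sub>v w = \<mu> \<cdot>\<^sub>v w"
proof -
  obtain w where w: "w \<in> carrier_vec n" "B *\<^sub>v w \<noteq> w"
  proof -
    \<comment> \<open>An entry where \<open>B\<close> differs from the identity lies in some column
      \<open>j\<close>, so the unit vector \<open>j\<close> is moved.\<close>
    obtain i j where ij: "i < n" "j < n" "B $$ (i, j) \<noteq> 1\<^sub>m n $$ (i, j)"
    proof (rule ccontr)
      assume "\<not> thesis"
      then have "B = 1\<^sub>m n"
        using B(1) \<open>\<And>i j. i < n \<Longrightarrow> j < n \<Longrightarrow> B $$ (i, j) \<noteq> 1\<^sub>m n $$ (i, j) \<Longrightarrow> thesis\<close>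
        by (intro eq_matI) (auto simp del: index_one_mat(1))
      then show False
        using B(3) by simp
    qed
    have "(B *\<^sub>v unit_vec n j) $ i = B $$ (i, j)"
      using B(1) ij by simp
    then have "B *\<^sub>v unit_vec n j \<noteq> unit_vec n j"
      using ij by auto
    then show thesis
      using that by (meson unit_vec_carrier)
  qed
  have "eigenpart B omega w \<noteq> 0\<^sub>v n \<or> eigenpart B (omega\<^sup>2) w \<noteq> 0\<^sub>v n"
  proof (rule ccontr)
    assume "\<not> (eigenpart B omega w \<noteq> 0\<^sub>v n \<or> eigenpart B (omega\<^sup>2) w \<noteq> 0\<^sub>v n)"
    then have z: "eigenpart B omega w = 0\<^sub>v n" "eigenpart B (omega\<^sup>2) w = 0\<^sub>v n"
      by auto
    have "eigenpart B 1 w = 3 \<cdot>\<^sub>v w"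
      using eigenpart_sum[OF B(1) w(1)] z
        eigenpart_carrier[OF B(1) w(1), of 1] by simp
    then have "B *\<^sub>v (3 \<cdot>\<^sub>v w) = 3 \<cdot>\<^sub>v w"
      using eigenpart_eigen[OF B(1,2) w(1), of 1] w(1) by simp
    then have "3 \<cdot>\<^sub>v (B *\<^sub>v w) = 3 \<cdot>\<^sub>v w"
      using B(1) w(1) by (simp add: mult_mat_vec[of _ n n])
    moreover have "x = (1 / 3) \<cdot>\<^sub>v (3 \<cdot>\<^sub>v x)" for x :: "complex vec"
      by (simp add: smult_smult_assoc)
    ultimately have "B *\<^sub>v w = w"
      by metis
    then show False
      using w(2) by simp
  qed
  then obtain \<mu> where \<mu>: "\<mu> ^ 3 = 1" "\<mu> \<noteq> 1" "eigenpart B \<mu> w \<noteq> 0\<^sub>v n"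
    using omega_cube omega_square_cube omega_neq by blast
  show thesis
    by (rule that[OF eigenpart_carrier[OF B(1) w(1)] \<mu>(3,2) eigenpart_eigen[OF B(1,2) w(1) \<mu>(1)]])
qed

lemma smult_vec_right_cancel:
  fixes v :: "'a :: field vec"
  assumes "a \<cdot>\<^sub>v v = b \<cdot>\<^sub>v v" "v \<in> carrier_vec n" "v \<noteq> 0\<^sub>v n"
  shows "a = b"
proof -
  obtain i where i: "i < n" "v $ i \<noteq> 0"
  proof (rule ccontr)
    assume *: "\<not> thesis"
    have "v = 0\<^sub>v n"
      using assms(2) * that by (intro eq_vecI) auto
    then show False
      using assms(3) by simp
  qed
  have "(a \<cdot>\<^sub>v v) $ i = (b \<cdot>\<^sub>v v) $ i"
    using assms(1) by simp
  then show ?thesis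
    using i assms(2) by simp
qed

text \<open>Passing to a nonzero eigenpart for the next matrix keeps all eigenvector equations
  already obtained, by commutation. The extra matrix \<open>C\<close> carries a prescribed
  eigenvalue \<open>k\<close> through the induction.\<close>

lemma ex_joint_eigenvector:
  fixes A :: "nat \<Rightarrow> complex mat"
  assumes A: "\<And>i. i < m \<Longrightarrow> A i \<in> carrier_mat n n" "\<And>i. i < m \<Longrightarrow> A i * A i * A i = 1\<^sub>m n"
    and comm: "\<And>i j. i < m \<Longrightarrow> j < m \<Longrightarrow> A i * A j = A j * A i"
    and C: "C \<in> carrier_mat n n" "\<And>i. i < m \<Longrightarrow> C * A i = A i * C"
    and w: "w \<in> carrier_vec n" "w \<noteq> 0\<^sub>v n" "C *\<^sub>v w = k \<cdot>\<^sub>v w"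
  shows "\<exists>v e. v \<in> carrier_vec n \<and> v \<noteq> 0\<^sub>v n \<and> C *\<^sub>v v = k \<cdot>\<^sub>v v \<and> (\<forall>i<m. A i *\<^sub>v v = e i \<cdot>\<^sub>v v)"
  using A comm C(2)
proof (induction m)
  case 0
  then show ?case
    using w by auto
next
  case (Suc m)
  have "\<exists>v e. v \<in> carrier_vec n \<and> v \<noteq> 0\<^sub>v n \<and> C *\<^sub>v v = k \<cdot>\<^sub>v v \<and> (\<forall>i<m. A i *\<^sub>v v = e i \<cdot>\<^sub>v v)"
    by (rule Suc.IH) (use Suc.prems in auto)
  then obtain v e where v: "v \<in> carrier_vec n" "v \<noteq> 0\<^sub>v n" "C *\<^sub>v v = k \<cdot>\<^sub>v v"
      "\<And>i. i < m \<Longrightarrow> A i *\<^sub>v v = e i \<cdot>\<^sub>v v"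
    by blast
  have Am: "A m \<in> carrier_mat n n" "A m * A m * A m = 1\<^sub>m n"
    using Suc.prems(1,2) by auto
  obtain \<mu> where \<mu>: "\<mu> ^ 3 = 1" "eigenpart (A m) \<mu> v \<noteq> 0\<^sub>v n"
    using ex_eigenvector_cube[OF Am v(1,2)] by blast
  let ?u = "eigenpart (A m) \<mu> v"
  have "?u \<in> carrier_vec n"
    using Am(1) v(1) by simp
  moreover have "C *\<^sub>v ?u = k \<cdot>\<^sub>v ?u"
    using Suc.prems(4)[of m] by (intro eigenpart_commute[OF Am(1) C(1) _ v(1,3)]) simp
  moreover have "A i *\<^sub>v ?u = (e(m := \<mu>)) i \<cdot>\<^sub>v ?u" if i: "i < Suc m" for i
  proof (cases "i = m")
    case True
    then show ?thesis
      using eigenpart_eigen[OF Am v(1) \<mu>(1)] by simp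
  next
    case False
    then have "A i *\<^sub>v v = e i \<cdot>\<^sub>v v"
      using v(4) i by simp
    then have "A i *\<^sub>v ?u = e i \<cdot>\<^sub>v ?u"
      using Suc.prems(1)[OF i] Suc.prems(3)[OF i, of m] by (intro eigenpart_commute[OF Am(1) _ _ v(1)]) auto
    then show ?thesis
      using False by simp
  qed
  ultimately show ?case
    using \<mu>(2) by blast
qed

text \<open>\<open>A j\<close> itself serves as the matrix with prescribed eigenvalue, which is
  chosen different from 1.\<close>

lemma joint_spectrum_nontrivial:
  fixes A :: "nat \<Rightarrow> complex mat"
  assumes A: "\<And>i. i < m \<Longrightarrow> A i \<in> carrier_mat n n" "\<And>i. i < m \<Longrightarrow> A i * A i * A i = 1\<^sub>m n"
    and comm: "\<And>i j. i < m \<Longrightarrow> j < m \<Longrightarrow> A i * A j = A j * A i"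
    and j: "j < m" "A j \<noteq> 1\<^sub>m n"
  obtains e where "e \<in> joint_spectrum n m A" "e j \<noteq> 1"
proof -
  obtain \<mu> w where w: "w \<in> carrier_vec n" "w \<noteq> 0\<^sub>v n" "\<mu> \<noteq> 1" "A j *\<^sub>v w = \<mu> \<cdot>\<^sub>v w"
    using ex_nontrivial_eigenvector[OF A(1,2)[OF j(1)] j(2)] by blast
  have "\<exists>v e. v \<in> carrier_vec n \<and> v \<noteq> 0\<^sub>v n \<and> A j *\<^sub>v v = \<mu> \<cdot>\<^sub>v v \<and> (\<forall>i<m. A i *\<^sub>v v = e i \<cdot>\<^sub>v v)"
    by (rule ex_joint_eigenvector) (use A comm j w in auto)
  then obtain v e where v: "v \<in> carrier_vec n" "v \<noteq> 0\<^sub>v n" "A j *\<^sub>v v = \<mu> \<cdot>\<^sub>v v"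
      "\<forall>i<m. A i *\<^sub>v v = e i \<cdot>\<^sub>v v"
    by blast
  have "e j = \<mu>"
    using v j(1) smult_vec_right_cancel by metis
  moreover have "restrict e {..<m} \<in> joint_spectrum n m A"
    unfolding joint_spectrum_def using v by auto
  ultimately show thesis
    using that[of "restrict e {..<m}"] j(1) w(3) by simp
qed

lemma joint_spectrum_cube:
  fixes A :: "nat \<Rightarrow> complex mat"
  assumes A: "A i \<in> carrier_mat n n" "A i * A i * A i = 1\<^sub>m n"
    and e: "e \<in> joint_spectrum n m A" "i < m"
  shows "e i ^ 3 = 1"
proof -
  obtain v where v: "v \<in> carrier_vec n" "v \<noteq> 0\<^sub>v n" "A i *\<^sub>v v = e i \<cdot>\<^sub>v v"
    using e unfolding joint_spectrum_def by blast
  have "v = A i *\<^sub>v (A i *\<^sub>v (A i *\<^sub>v v))"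
    using cube_mult_vec[OF A(1) v(1) A(2)] by simp
  also have "\<dots> = (e i ^ 3) \<cdot>\<^sub>v v"
    using v(1,3) by (simp add: mult_mat_vec[OF A(1)] smult_smult_assoc power3_eq_cube mult.assoc)
  finally have "(e i ^ 3) \<cdot>\<^sub>v v = 1 \<cdot>\<^sub>v v"
    by simp
  then show ?thesis
    using smult_vec_right_cancel v(1,2) by blast
qed

text \<open>Conjugating an eigenvector equation of a real matrix conjugates only the vector and the
  eigenvalue.\<close>

lemma joint_spectrum_cnj:
  assumes A: "\<And>i. i < m \<Longrightarrow> A i \<in> carrier_mat n n"
    and e: "e \<in> joint_spectrum n m (\<lambda>i. map_mat complex_of_real (A i))"
  shows "(\<lambda>i\<in>{..<m}. cnj (e i)) \<in> joint_spectrum n m (\<lambda>i. map_mat complex_of_real (A i))"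
proof -
  obtain v where v: "v \<in> carrier_vec n" "v \<noteq> 0\<^sub>v n"
      "\<And>i. i < m \<Longrightarrow> map_mat complex_of_real (A i) *\<^sub>v v = e i \<cdot>\<^sub>v v"
    using e unfolding joint_spectrum_def by blast
  have "map_mat complex_of_real (A i) *\<^sub>v conjugate v = cnj (e i) \<cdot>\<^sub>v conjugate v" if i: "i < m" for i
  proof -
    have "map_mat complex_of_real (A i) *\<^sub>v conjugate v = conjugate (map_mat complex_of_real (A i) *\<^sub>v v)"
      using A[OF i] v(1) by (intro eq_vecI) (auto simp: scalar_prod_def cnj_sum)
    also have "\<dots> = conjugate (e i \<cdot>\<^sub>v v)"
      using v(3)[OF i] by simp
    also have "\<dots> = cnj (e i) \<cdot>\<^sub>v conjugate v"
      by (intro eq_vecI) auto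
    finally show ?thesis .
  qed
  moreover have "conjugate v \<noteq> 0\<^sub>v n" "conjugate v \<in> carrier_vec n"
    using v(1,2) by auto
  ultimately show ?thesis
    unfolding joint_spectrum_def by (auto intro!: bexI[of _ "conjugate v"])
qed

section \<open>Permutation-invariant sets of functions\<close>

definition fiber :: "nat \<Rightarrow> (nat \<Rightarrow> 'a) \<Rightarrow> 'a \<Rightarrow> nat set" where
  "fiber m e x = {i. i < m \<and> e i = x}"

lemma finite_fiber [simp]: "finite (fiber m e x)"
  by (simp add: fiber_def)

lemma fiber_subset: "fiber m e x \<subseteq> {..<m}"
  by (auto simp: fiber_def)

text \<open>Glue a bijection from \<open>T\<close> to \<open>S\<close> with one between the
  complements. The direction is such that the preimage of \<open>S\<close> under
  \<open>\<pi>\<close> is \<open>T\<close>, so a fiber \<open>S\<close> of \<open>e\<close> becomes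
  the fiber \<open>T\<close> of \<open>e \<circ> \<pi>\<close>.\<close>

lemma ex_permutes_subset:
  assumes "finite A" "S \<subseteq> A" "T \<subseteq> A" "card S = card T"
  obtains \<pi> where "\<pi> permutes A" "\<And>i. i \<in> A \<Longrightarrow> \<pi> i \<in> S \<longleftrightarrow> i \<in> T"
proof -
  have fin: "finite S" "finite T" "finite (A - S)" "finite (A - T)"
    using assms finite_subset by auto
  obtain f where f: "bij_betw f T S"
    using finite_same_card_bij[OF fin(2,1)] assms(4) by auto
  have "card (A - T) = card (A - S)"
    using assms fin by (simp add: card_Diff_subset)
  then obtain g where g: "bij_betw g (A - T) (A - S)"
    using finite_same_card_bij[OF fin(4,3)] by auto
  define \<pi> where "\<pi> i = (if i \<in> T then f i else if i \<in> A then g i else i)" for i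
  have "bij_betw \<pi> T S"
    using f by (rule bij_betw_cong[THEN iffD1, rotated]) (simp add: \<pi>_def)
  moreover have "bij_betw \<pi> (A - T) (A - S)"
    using g by (rule bij_betw_cong[THEN iffD1, rotated]) (simp add: \<pi>_def)
  ultimately have "bij_betw \<pi> (T \<union> (A - T)) (S \<union> (A - S))"
    by (rule bij_betw_combine) auto
  then have "bij_betw \<pi> A A"
    using assms(2,3) by (simp add: Un_absorb1)
  then have "\<pi> permutes A"
    using assms(3) by (intro bij_imp_permutes) (auto simp: \<pi>_def)
  moreover have "\<pi> i \<in> S \<longleftrightarrow> i \<in> T" if "i \<in> A" for i
    using that \<open>bij_betw \<pi> T S\<close> \<open>bij_betw \<pi> (A - T) (A - S)\<close> unfolding bij_betw_def by blast
  ultimately show thesis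
    by (rule that)
qed

definition permutation_closed :: "nat \<Rightarrow> (nat \<Rightarrow> 'a) set \<Rightarrow> bool" where
  "permutation_closed m L \<longleftrightarrow>
     (\<forall>e\<in>L. \<forall>\<pi>. \<pi> permutes {..<m} \<longrightarrow> (\<lambda>i\<in>{..<m}. e (\<pi> i)) \<in> L)"

text \<open>Rearranging \<open>e\<close> turns its fiber over \<open>x\<close> into any prescribed
  subset of the same size, so taking fibers over \<open>x\<close> maps onto all such subsets.
  Counting only functions with this fiber size allows two such families to be shown disjoint
  later.\<close>

lemma card_permutation_orbit_ge:
  fixes L :: "(nat \<Rightarrow> 'a) set"
  assumes fin: "finite L"
    and perm: "permutation_closed m L"
    and e: "e \<in> L"
  shows "m choose card (fiber m e x) \<le> card {d \<in> L. card (fiber m d x) = card (fiber m e x)}"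
proof -
  let ?k = "card (fiber m e x)"
  have "{T. T \<subseteq> {..<m} \<and> card T = ?k} \<subseteq> (\<lambda>d. fiber m d x) ` {d \<in> L. card (fiber m d x) = ?k}"
  proof
    fix T
    assume "T \<in> {T. T \<subseteq> {..<m} \<and> card T = ?k}"
    then have T: "T \<subseteq> {..<m}" "card T = ?k"
      by auto
    obtain \<pi> where \<pi>: "\<pi> permutes {..<m}" "\<And>i. i \<in> {..<m} \<Longrightarrow> \<pi> i \<in> fiber m e x \<longleftrightarrow> i \<in> T"
      using ex_permutes_subset[OF finite_lessThan fiber_subset T(1) T(2)[symmetric]] by blast
    let ?d = "\<lambda>i\<in>{..<m}. e (\<pi> i)"
    have "\<pi> i < m" if "i < m" for i
      using permutes_in_image[OF \<pi>(1)] that by simp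
    then have "fiber m ?d x = T"
      using \<pi>(2) T(1) by (auto simp: fiber_def)
    moreover have "?d \<in> L"
      using perm e \<pi>(1) unfolding permutation_closed_def by blast
    ultimately show "T \<in> (\<lambda>d. fiber m d x) ` {d \<in> L. card (fiber m d x) = ?k}"
      using T(2) by (intro image_eqI[of _ _ ?d]) auto
  qed
  then have "card {T. T \<subseteq> {..<m} \<and> card T = ?k} \<le> card {d \<in> L. card (fiber m d x) = ?k}"
    using fin by (intro surj_card_le) auto
  then show ?thesis
    by (simp add: n_subsets)
qed

lemma choose_8:
  assumes "1 \<le> k" "k \<le> (7 :: nat)"
  shows "8 \<le> 8 choose k" "2 \<le> k \<Longrightarrow> k \<le> 6 \<Longrightarrow> 16 \<le> 8 choose k"
proof -
  have "k \<in> {1, 2, 3, 4, 5, 6, 7}"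
    using assms by auto
  then show "8 \<le> 8 choose k" "2 \<le> k \<Longrightarrow> k \<le> 6 \<Longrightarrow> 16 \<le> 8 choose k"
    by (auto simp: numeral_eq_Suc)
qed

lemma card_fiber_bounds:
  assumes "i < m" "e i = x" "j < m" "e j \<noteq> x"
  shows "1 \<le> card (fiber m e x)" "card (fiber m e x) < m"
proof -
  have "i \<in> fiber m e x"
    using assms by (simp add: fiber_def)
  then show "1 \<le> card (fiber m e x)"
    by (simp add: Suc_le_eq card_gt_0_iff) blast
  have "fiber m e x \<subset> {..<m}"
    using assms by (auto simp: fiber_def)
  then show "card (fiber m e x) < m"
    using psubset_card_mono[of "{..<m}" "fiber m e x"] by simp
qed

lemma card_ge_8:
  fixes L :: "(nat \<Rightarrow> 'a) set"
  assumes fin: "finite L"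
    and perm: "permutation_closed 8 L"
    and e: "e \<in> L" "i < 8" "j < 8" "e i \<noteq> e j"
  shows "8 \<le> card L"
proof -
  have k: "1 \<le> card (fiber 8 e (e i))" "card (fiber 8 e (e i)) < 8"
    by (rule card_fiber_bounds[of i _ _ _ j]; use e in simp)+
  then have "8 \<le> 8 choose card (fiber 8 e (e i))"
    by (intro choose_8) auto
  also have "\<dots> \<le> card {d \<in> L. card (fiber 8 d (e i)) = card (fiber 8 e (e i))}"
    by (rule card_permutation_orbit_ge[OF fin perm e(1)])
  also have "\<dots> \<le> card L"
    using fin by (intro card_mono) auto
  finally show ?thesis .
qed

text \<open>If no fiber has between 2 and 6 elements, then one has seven. The product condition
  makes its value \<open>x\<close> nonreal, and the functions taking \<open>x\<close> seven times
  and those taking \<open>cnj x\<close> seven times form disjoint families of at least 8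
  each.\<close>

lemma card_ge_16:
  fixes L :: "(nat \<Rightarrow> complex) set"
  assumes fin: "finite L"
    and perm: "permutation_closed 8 L"
    and conj: "\<And>e. e \<in> L \<Longrightarrow> (\<lambda>i\<in>{..<8}. cnj (e i)) \<in> L"
    and e: "e \<in> L" "\<And>i. i < 8 \<Longrightarrow> e i ^ 3 = 1" "(\<Prod>i<8. e i) = 1"
    and nonconst: "i < 8" "j < 8" "e i \<noteq> e j"
  shows "16 \<le> card L"
proof (cases "\<exists>x. 2 \<le> card (fiber 8 e x) \<and> card (fiber 8 e x) \<le> 6")
  case True
  then obtain x where x: "2 \<le> card (fiber 8 e x)" "card (fiber 8 e x) \<le> 6"
    by blast
  then have "16 \<le> 8 choose card (fiber 8 e x)"
    by (intro choose_8(2)) auto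
  also have "\<dots> \<le> card {d \<in> L. card (fiber 8 d x) = card (fiber 8 e x)}"
    by (rule card_permutation_orbit_ge[OF fin perm e(1)])
  also have "\<dots> \<le> card L"
    using fin by (intro card_mono) auto
  finally show ?thesis .
next
  case False
  \<comment> \<open>Pigeonhole: eight indices, but only three cube roots of unity.\<close>
  have "\<exists>x. 2 \<le> card (fiber 8 e x)"
  proof (rule ccontr)
    assume *: "\<not> (\<exists>x. 2 \<le> card (fiber 8 e x))"
    have "inj_on e {..<8}"
    proof (rule inj_onI, rule ccontr)
      fix a b
      assume "a \<in> {..<8}" "b \<in> {..<8}" "e a = e b" "a \<noteq> b"
      then have "{a, b} \<subseteq> fiber 8 e (e a)" "card {a, b} = 2"
        by (auto simp: fiber_def)
      then show False
        using * card_mono[OF finite_fiber] by metis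
    qed
    moreover have "e ` {..<8} \<subseteq> {z. z ^ 3 = 1}"
      using e(2) by auto
    moreover have "finite {z :: complex. z ^ 3 = 1}" "card {z :: complex. z ^ 3 = 1} = 3"
      using finite_roots_unity[of 3] card_roots_unity_eq[of 3] by auto
    ultimately show False
      using card_inj_on_le[of e "{..<8}" "{z. z ^ 3 = 1}"] by simp
  qed
  then obtain x where x: "2 \<le> card (fiber 8 e x)"
    by blast
  have "card (fiber 8 e x) < 8"
  proof -
    obtain a where "a < 8" "e a = x"
      using x by (metis (mono_tags, lifting) card.empty empty_Collect_eq fiber_def not_numeral_le_zero)
    moreover obtain b where "b < 8" "e b \<noteq> x"
      using nonconst by metis
    ultimately show ?thesis
      by (rule card_fiber_bounds)
  qed
  moreover have "\<not> card (fiber 8 e x) \<le> 6"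
    using x False by blast
  ultimately have seven: "card (fiber 8 e x) = 7"
    by simp
  have "card ({..<8} - fiber 8 e x) = 1"
    using card_Diff_subset[OF finite_fiber fiber_subset, of 8 e x] seven by simp
  then obtain b where b: "{..<8} - fiber 8 e x = {b}"
    using card_1_singletonE by blast
  have "(\<Prod>i<8. e i) = (\<Prod>i\<in>{b}. e i) * (\<Prod>i\<in>fiber 8 e x. e i)"
    using prod.subset_diff[OF fiber_subset finite_lessThan] b by metis
  also have "(\<Prod>i\<in>fiber 8 e x. e i) = (\<Prod>i\<in>fiber 8 e x. x)"
    by (rule prod.cong) (auto simp: fiber_def)
  also have "\<dots> = x ^ 7"
    by (simp add: seven)
  finally have bx: "e b * x ^ 7 = 1"
    using e(3) by simp
  have "b < 8" "e b \<noteq> x"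
    using b by (auto simp: fiber_def)
  moreover have x3: "x ^ 3 = 1"
  proof -
    obtain a where "a < 8" "e a = x"
      using x by (metis (mono_tags, lifting) card.empty empty_Collect_eq fiber_def not_numeral_le_zero)
    then show ?thesis
      using e(2) by blast
  qed
  \<comment> \<open>For \<open>x = 1\<close> the product equation would read \<open>e b = 1\<close>,
    contradicting \<open>e b \<noteq> x\<close>.\<close>
  ultimately have "x \<noteq> 1"
    using bx by auto
  have "cnj x \<noteq> x"
  proof
    assume "cnj x = x"
    have "norm x ^ 3 = 1"
      using x3 by (simp flip: norm_power)
    then have "norm x = 1"
      using power_eq_1_iff by fastforce
    \<comment> \<open>A real \<open>x\<close> of norm 1 has square 1; together with
      \<open>x ^ 3 = 1\<close> this gives \<open>x = 1\<close>.\<close>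
    then have "x * x = 1"
      using \<open>cnj x = x\<close> complex_norm_square[of x] by simp
    then show False
      using x3 \<open>x \<noteq> 1\<close> by (simp add: power3_eq_cube)
  qed
  let ?e = "restrict (\<lambda>i. cnj (e i)) {..<8}"
  have "fiber 8 ?e (cnj x) = fiber 8 e x"
    by (auto simp: fiber_def)
  then have seven_conj: "card (fiber 8 ?e (cnj x)) = 7"
    using seven by simp
  let ?L = "\<lambda>x. {d \<in> L. card (fiber 8 d x) = 7}"
  have "8 choose 7 = (8 :: nat)"
    by (simp add: numeral_eq_Suc)
  then have "8 \<le> card (?L x)" "8 \<le> card (?L (cnj x))"
    using card_permutation_orbit_ge[OF fin perm e(1), of x] card_permutation_orbit_ge[OF fin perm conj[OF e(1)], of "cnj x"] seven seven_conj
    by simp_all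
  moreover have "?L x \<inter> ?L (cnj x) = {}"
  proof (rule ccontr)
    assume "?L x \<inter> ?L (cnj x) \<noteq> {}"
    then obtain d where d: "card (fiber 8 d x) = 7" "card (fiber 8 d (cnj x)) = 7"
      by blast
    \<comment> \<open>Two disjoint fibers of seven elements do not fit into eight indices.\<close>
    have "fiber 8 d x \<inter> fiber 8 d (cnj x) = {}"
      using \<open>cnj x \<noteq> x\<close> by (auto simp: fiber_def)
    then have "card (fiber 8 d x \<union> fiber 8 d (cnj x)) = 14"
      using d by (simp add: card_Un_disjoint)
    moreover have "card (fiber 8 d x \<union> fiber 8 d (cnj x)) \<le> card {..<8 :: nat}"
      by (intro card_mono Un_least fiber_subset) simp
    ultimately show False
      by simp
  qed
  ultimately have "16 \<le> card (?L x \<union> ?L (cnj x))"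
    using fin by (simp add: card_Un_disjoint)
  also have "\<dots> \<le> card L"
    using fin by (intro card_mono) auto
  finally show ?thesis .
qed

section \<open>The cube group inside the wreath product\<close>

text \<open>The binary digits of \<open>i\<close>, lowest first, are the signs of the x, y and z
  coordinates. Corner 0 is bottom-front-left, and corners 4 to 7 form the top layer.\<close>

definition corner :: "nat \<Rightarrow> vec3" where
  "corner i = (if odd i then 1 else -1, if odd (i div 2) then 1 else -1, if odd (i div 4) then 1 else -1)"

text \<open>The sticker with index \<open>k\<close> is reached from the horizontal-face sticker of its cubelet by \<open>k\<close> steps
  around the corner, always in the same sense as seen from outside; the sign of \<open>a * b * c\<close> accounts
  for the handedness of the corner.\<close>

definition sticker_at :: "nat \<Rightarrow> nat \<Rightarrow> sticker" where
  "sticker_at i k = (case corner i of (a, b, c) \<Rightarrow>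
     ((a, b, c), if k = 0 then (0, 0, c) else if (k = 1) = (a * b * c = 1) then (a, 0, 0) else (0, b, 0)))"

text \<open>\<open>corner_of\<close> and \<open>twist_of\<close> read off the two arguments of
  \<open>sticker_at\<close> from a sticker.\<close>

fun corner_of :: "sticker \<Rightarrow> nat" where
  "corner_of ((a, b, c), v) = (if a = 1 then 1 else 0) + (if b = 1 then 2 else 0) + (if c = 1 then 4 else 0)"

fun twist_of :: "sticker \<Rightarrow> nat" where
  "twist_of ((a, b, c), (x, y, z)) = (if z \<noteq> 0 then 0 else if (x \<noteq> 0) = (a * b * c = 1) then 1 else 2)"

lemma sticker_at_corner_twist [simp]:
  assumes "s \<in> stickers"
  shows "sticker_at (corner_of s) (twist_of s) = s" "corner_of s < 8" "twist_of s < 3"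
proof -
  obtain a b c v where s: "s = ((a, b, c), v)"
    by (metis prod.exhaust)
  then have "a = -1 \<or> a = 1" "b = -1 \<or> b = 1" "c = -1 \<or> c = 1"
    and "v = (a, 0, 0) \<or> v = (0, b, 0) \<or> v = (0, 0, c)"
    using assms by (auto simp: stickers_def corner_positions_def)
  then have "sticker_at (corner_of s) (twist_of s) = s \<and> corner_of s < 8 \<and> twist_of s < 3"
    unfolding s by (elim disjE) (simp_all add: sticker_at_def corner_def)
  then show "sticker_at (corner_of s) (twist_of s) = s" "corner_of s < 8" "twist_of s < 3"
    by blast+
qed

lemma sticker_cases:
  assumes "s \<in> stickers"
  obtains i k where "i < 8" "k < 3" "s = sticker_at i k"
  using sticker_at_corner_twist[OF assms] that by metis

lemma sticker_at_simps [simp]: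
  assumes "i < 8" "k < 3"
  shows sticker_at_in: "sticker_at i k \<in> stickers"
    and corner_of_sticker_at: "corner_of (sticker_at i k) = i"
    and twist_of_sticker_at: "twist_of (sticker_at i k) = k"
proof -
  have "k \<in> {0, 1, 2}" "i \<in> {0, 1, 2, 3, 4, 5, 6, 7}"
    using assms by auto
  then show "sticker_at i k \<in> stickers" "corner_of (sticker_at i k) = i" "twist_of (sticker_at i k) = k"
    by (auto simp: sticker_at_def corner_def stickers_def corner_positions_def)
qed

text \<open>The twist \<open>\<tau>\<close> is indexed by the position that a cubelet leaves, not by
  the one it reaches. Only its residues modulo 3 matter.\<close>

definition wreath :: "(nat \<Rightarrow> nat) \<Rightarrow> (nat \<Rightarrow> nat) \<Rightarrow> sticker \<Rightarrow> sticker" where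
  "wreath \<pi> \<tau> = (\<lambda>s\<in>stickers. sticker_at (\<pi> (corner_of s)) ((twist_of s + \<tau> (corner_of s)) mod 3))"

lemma wreath_sticker_at:
  "i < 8 \<Longrightarrow> k < 3 \<Longrightarrow> wreath \<pi> \<tau> (sticker_at i k) = sticker_at (\<pi> i) ((k + \<tau> i) mod 3)"
  by (simp add: wreath_def)

lemma extensional_stickers_eqI:
  assumes "f \<in> extensional stickers" "g \<in> extensional stickers"
    and "\<And>i k. i < 8 \<Longrightarrow> k < 3 \<Longrightarrow> f (sticker_at i k) = g (sticker_at i k)"
  shows "f = g"
  using assms(1,2)
proof (rule extensionalityI)
  fix s
  assume "s \<in> stickers"
  then show "f s = g s"
    by (rule sticker_cases) (simp add: assms(3))
qed

lemma wreath_extensional [simp]: "wreath \<pi> \<tau> \<in> extensional stickers"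
  by (simp add: wreath_def)

lemma wreath_cong:
  assumes "\<And>i. i < 8 \<Longrightarrow> \<pi> i = \<pi>' i" "\<And>i. i < 8 \<Longrightarrow> \<tau> i mod 3 = \<tau>' i mod 3"
  shows "wreath \<pi> \<tau> = wreath \<pi>' \<tau>'"
proof (rule extensional_stickers_eqI)
  fix i k :: nat
  assume "i < 8" "k < 3"
  then show "wreath \<pi> \<tau> (sticker_at i k) = wreath \<pi>' \<tau>' (sticker_at i k)"
    using mod_add_cong[OF refl assms(2)] by (simp add: wreath_sticker_at assms(1))
qed simp_all

text \<open>The multiplication law of the wreath product: the cubelet at \<open>i\<close> is twisted
  by \<open>\<tau>' i\<close> on the way to \<open>\<pi>' i\<close> and from there by
  \<open>\<tau> (\<pi>' i)\<close>.\<close>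

lemma compose_wreath:
  assumes "\<And>i. i < 8 \<Longrightarrow> \<pi>' i < 8"
  shows "compose stickers (wreath \<pi> \<tau>) (wreath \<pi>' \<tau>') = wreath (\<pi> \<circ> \<pi>') (\<lambda>i. \<tau>' i + \<tau> (\<pi>' i))"
  by (rule extensional_stickers_eqI)
    (simp_all add: compose_def wreath_sticker_at assms mod_add_left_eq add.assoc)

lemma wreath_id: "wreath id (\<lambda>_. 0) = (\<lambda>s\<in>stickers. s)"
  by (rule extensional_stickers_eqI) (simp_all add: wreath_sticker_at)

text \<open>Twists count modulo 3, so \<open>2 * \<tau>\<close> stands for \<open>- \<tau>\<close>.\<close>

lemma wreath_inverse:
  assumes "bij_betw \<pi> {..<8} {..<8}"
  shows "compose stickers (wreath (inv_into {..<8} \<pi>) (\<lambda>i. 2 * \<tau> (inv_into {..<8} \<pi> i))) (wreath \<pi> \<tau>)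
         = (\<lambda>s\<in>stickers. s)"
proof -
  have "\<pi> i < 8" if "i < 8" for i
    using assms that by (auto simp: bij_betw_def)
  moreover have "inv_into {..<8} \<pi> (\<pi> i) = i" if "i < 8" for i
    using assms that by (simp add: bij_betw_inv_into_left)
  moreover have "(\<tau> i + 2 * \<tau> i) mod 3 = 0" for i
    by presburger
  ultimately show ?thesis
    unfolding wreath_id[symmetric] by (subst compose_wreath) (auto intro!: wreath_cong)
qed

text \<open>The left inverse gives injectivity, and on the finite set of stickers an injective
  self-map is surjective.\<close>

lemma wreath_in_Bij:
  assumes "bij_betw \<pi> {..<8} {..<8}"
  shows "wreath \<pi> \<tau> \<in> Bij stickers"
proof -
  let ?\<rho> = "inv_into {..<8} \<pi>"
  have maps: "wreath \<sigma> \<upsilon> ` stickers \<subseteq> stickers" if "\<And>i. i < 8 \<Longrightarrow> \<sigma> i < 8" for \<sigma> \<upsilon>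
    using that by (auto simp: wreath_def)
  have lt: "\<pi> i < 8" if "i < 8" for i
    using assms that by (auto simp: bij_betw_def)
  have inj: "inj_on (wreath \<pi> \<tau>) stickers"
  proof (rule inj_onI)
    fix s t
    assume st: "s \<in> stickers" "t \<in> stickers" and eq: "wreath \<pi> \<tau> s = wreath \<pi> \<tau> t"
    have "compose stickers (wreath ?\<rho> (\<lambda>i. 2 * \<tau> (?\<rho> i))) (wreath \<pi> \<tau>) s
        = compose stickers (wreath ?\<rho> (\<lambda>i. 2 * \<tau> (?\<rho> i))) (wreath \<pi> \<tau>) t"
      using st eq by (simp add: compose_eq)
    then show "s = t"
      using st by (simp add: wreath_inverse[OF assms])
  qed
  have "finite stickers"
  proof (rule finite_subset)
    show "stickers \<subseteq> (\<lambda>(i, k). sticker_at i k) ` ({..<8} \<times> {..<3})"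
    proof
      fix s
      assume "s \<in> stickers"
      then show "s \<in> (\<lambda>(i, k). sticker_at i k) ` ({..<8} \<times> {..<3})"
        by (rule sticker_cases) auto
    qed
  qed simp
  then have "bij_betw (wreath \<pi> \<tau>) stickers stickers"
    using inj maps[OF lt] by (simp add: bij_betw_def endo_inj_surj)
  then show ?thesis
    by (simp add: Bij_def)
qed

section \<open>The six moves as tables, and the elements of the generated group\<close>

type_synonym move_table = "nat list \<times> nat list"

definition wreath_table :: "move_table \<Rightarrow> sticker \<Rightarrow> sticker" where
  "wreath_table x = wreath ((!) (fst x)) ((!) (snd x))"

text \<open>The first list gives the new position of each corner, the second its twist. Turns of the
  top and bottom layers keep horizontal stickers horizontal and have no twist; in each of the other
  four tables the twists add up to 6.\<close>

definition tab_u :: move_table where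
  "tab_u = ([0, 1, 2, 3, 6, 4, 7, 5], [0, 0, 0, 0, 0, 0, 0, 0])"
definition tab_d :: move_table where
  "tab_d = ([1, 3, 0, 2, 4, 5, 6, 7], [0, 0, 0, 0, 0, 0, 0, 0])"
definition tab_f :: move_table where
  "tab_f = ([4, 0, 2, 3, 5, 1, 6, 7], [1, 2, 0, 0, 2, 1, 0, 0])"
definition tab_b :: move_table where
  "tab_b = ([0, 1, 3, 7, 4, 5, 2, 6], [0, 0, 2, 1, 0, 0, 1, 2])"
definition tab_l :: move_table where
  "tab_l = ([2, 1, 6, 3, 0, 5, 4, 7], [2, 0, 1, 0, 1, 0, 2, 0])"
definition tab_r :: move_table where
  "tab_r = ([0, 5, 2, 1, 4, 7, 6, 3], [0, 1, 0, 2, 0, 2, 0, 1])"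

text \<open>Reduces the equality of two maps to an evaluable check on the 24 stickers.\<close>

lemma face_move_eq_wreath_tableI:
  assumes "list_all (\<lambda>i. list_all (\<lambda>k.
      (case sticker_at i k of (p, v) \<Rightarrow> if dot3 n p > 0 then (rot_cw n p, rot_cw n v) else (p, v))
      = sticker_at (fst x ! i) ((k + snd x ! i) mod 3)) [0..<3]) [0..<8]"
  shows "face_move n = wreath_table x"
proof (rule extensional_stickers_eqI)
  fix i k :: nat
  assume "i < 8" "k < 3"
  then show "face_move n (sticker_at i k) = wreath_table x (sticker_at i k)"
    using assms by (simp add: list_all_iff face_move_def wreath_table_def wreath_sticker_at)
qed (simp_all add: face_move_def wreath_table_def)

lemma move_tables:
  "move_u = wreath_table tab_u" "move_d = wreath_table tab_d" "move_f = wreath_table tab_f"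
  "move_b = wreath_table tab_b" "move_l = wreath_table tab_l" "move_r = wreath_table tab_r"
  unfolding move_u_def move_d_def move_f_def move_b_def move_l_def move_r_def
  by (rule face_move_eq_wreath_tableI; code_simp)+

lemma all_less_8: "(\<forall>i<8. P i) \<longleftrightarrow> P 0 \<and> P 1 \<and> P 2 \<and> P 3 \<and> P 4 \<and> P 5 \<and> P 6 \<and> P (7 :: nat)"
  by (simp add: numeral_eq_Suc All_less_Suc) blast

lemma tables_bij:
  assumes "x \<in> {tab_u, tab_d, tab_f, tab_b, tab_l, tab_r}"
  shows "length (fst x) = 8" "length (snd x) = 8" "distinct (fst x)" "set (fst x) = {..<8}"
proof -
  have "list_all (\<lambda>x. length (fst x) = 8 \<and> length (snd x) = 8 \<and> distinct (fst x) \<and> set (fst x) = set [0..<8])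
    [tab_u, tab_d, tab_f, tab_b, tab_l, tab_r]"
    by code_simp
  then show "length (fst x) = 8" "length (snd x) = 8" "distinct (fst x)" "set (fst x) = {..<8}"
    using assms unfolding list_all_iff by (auto simp only: list.set set_upt atLeast0LessThan)
qed

lemma nth_bij_betw:
  assumes "distinct xs" "set xs = {..<8}" "length xs = 8"
  shows "bij_betw ((!) xs) {..<8} {..<8}"
  using bij_betw_nth[OF assms(1) refl] assms by (metis lessThan_atLeast0)

lemma moves_wreath:
  assumes "m \<in> {move_u, move_d, move_f, move_b, move_l, move_r}"
  obtains \<pi> \<tau> where "bij_betw \<pi> {..<8} {..<8}" "m = wreath \<pi> \<tau>"
proof -
  obtain x where "x \<in> {tab_u, tab_d, tab_f, tab_b, tab_l, tab_r}" "m = wreath_table x"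
    using assms move_tables by blast
  then show thesis
    using nth_bij_betw[OF tables_bij(3,4,1)] that unfolding wreath_table_def by blast
qed

lemma moves_in_Bij: "{move_u, move_d, move_f, move_b, move_l, move_r} \<subseteq> carrier (BijGroup stickers)"
proof
  fix m
  assume "m \<in> {move_u, move_d, move_f, move_b, move_l, move_r}"
  then obtain \<pi> \<tau> where "bij_betw \<pi> {..<8} {..<8}" "m = wreath \<pi> \<tau>"
    by (rule moves_wreath)
  then show "m \<in> carrier (BijGroup stickers)"
    using wreath_in_Bij by (simp add: BijGroup_def)
qed

lemma carrier_G2: "carrier G2 = generate (BijGroup stickers) {move_u, move_d, move_f, move_b, move_l, move_r}"
  by (simp add: G2_def)

lemma G2_subset_Bij: "carrier G2 \<subseteq> Bij stickers"
  using group.generate_incl[OF group_BijGroup moves_in_Bij]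
  unfolding carrier_G2 by (simp add: BijGroup_def)

lemma group_G2: "group G2"
  unfolding G2_def
  using group.generate_is_subgroup[OF group_BijGroup moves_in_Bij] group_BijGroup
  by (rule subgroup.subgroup_is_group)

lemma mult_G2: "g \<in> carrier G2 \<Longrightarrow> h \<in> carrier G2 \<Longrightarrow> g \<otimes>\<^bsub>G2\<^esub> h = compose stickers g h"
  using G2_subset_Bij by (auto simp: G2_def BijGroup_def)

lemma one_G2: "\<one>\<^bsub>G2\<^esub> = wreath id (\<lambda>_. 0)"
  by (simp add: G2_def BijGroup_def wreath_id)

text \<open>The moves have this form, and it is preserved by inverses and products, so induction
  over the generated subgroup applies.\<close>

lemma G2_wreath:
  assumes "g \<in> carrier G2"
  obtains \<pi> \<tau> where "bij_betw \<pi> {..<8} {..<8}" "g = wreath \<pi> \<tau>"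
proof -
  have "\<exists>\<pi> \<tau>. bij_betw \<pi> {..<8} {..<8} \<and> g = wreath \<pi> \<tau>"
    using assms unfolding carrier_G2
  proof (induction rule: generate.induct)
    case one
    show ?case
      using bij_betw_id wreath_id by (metis BijGroup_def monoid.select_convs(2))
  next
    case (incl h)
    then show ?case
      by (meson moves_wreath)
  next
    case (inv h)
    then obtain \<pi> \<tau> where \<pi>: "bij_betw \<pi> {..<8} {..<8}" and h: "h = wreath \<pi> \<tau>"
      by (rule moves_wreath)
    let ?\<rho> = "inv_into {..<8} \<pi>"
    have \<rho>: "bij_betw ?\<rho> {..<8} {..<8}"
      using \<pi> by (rule bij_betw_inv_into)
    have "inv\<^bsub>BijGroup stickers\<^esub> h = wreath ?\<rho> (\<lambda>i. 2 * \<tau> (?\<rho> i))"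
      using wreath_in_Bij[OF \<pi>] wreath_in_Bij[OF \<rho>] wreath_inverse[OF \<pi>]
      by (intro group.inv_equality[OF group_BijGroup]) (simp_all add: BijGroup_def h)
    then show ?case
      using \<rho> by blast
  next
    case (eng h\<^sub>1 h\<^sub>2)
    then obtain \<pi>\<^sub>1 \<tau>\<^sub>1 \<pi>\<^sub>2 \<tau>\<^sub>2 where h:
      "bij_betw \<pi>\<^sub>1 {..<8} {..<8}" "h\<^sub>1 = wreath \<pi>\<^sub>1 \<tau>\<^sub>1"
      "bij_betw \<pi>\<^sub>2 {..<8} {..<8}" "h\<^sub>2 = wreath \<pi>\<^sub>2 \<tau>\<^sub>2"
      by blast
    have lt: "\<pi>\<^sub>2 i < 8" if "i < 8" for i
      using h(3) that by (auto simp: bij_betw_def)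
    have "h\<^sub>1 \<otimes>\<^bsub>BijGroup stickers\<^esub> h\<^sub>2 = compose stickers h\<^sub>1 h\<^sub>2"
      using h wreath_in_Bij by (simp add: BijGroup_def)
    also have "\<dots> = wreath (\<pi>\<^sub>1 \<circ> \<pi>\<^sub>2) (\<lambda>i. \<tau>\<^sub>2 i + \<tau>\<^sub>1 (\<pi>\<^sub>2 i))"
      unfolding h by (rule compose_wreath) (rule lt)
    finally show ?case
      using bij_betw_trans[OF h(3) h(1)] by blast
  qed
  then show thesis
    using that by blast
qed

lemma wreath_mult_G2:
  assumes "wreath \<pi> \<tau> \<in> carrier G2" "wreath \<pi>' \<tau>' \<in> carrier G2" "\<And>i. i < 8 \<Longrightarrow> \<pi>' i < 8"
  shows "wreath \<pi> \<tau> \<otimes>\<^bsub>G2\<^esub> wreath \<pi>' \<tau>' = wreath (\<pi> \<circ> \<pi>') (\<lambda>i. \<tau>' i + \<tau> (\<pi>' i))"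
    and "wreath (\<pi> \<circ> \<pi>') (\<lambda>i. \<tau>' i + \<tau> (\<pi>' i)) \<in> carrier G2"
proof -
  show eq: "wreath \<pi> \<tau> \<otimes>\<^bsub>G2\<^esub> wreath \<pi>' \<tau>' = wreath (\<pi> \<circ> \<pi>') (\<lambda>i. \<tau>' i + \<tau> (\<pi>' i))"
    using assms by (simp add: mult_G2 compose_wreath)
  show "wreath (\<pi> \<circ> \<pi>') (\<lambda>i. \<tau>' i + \<tau> (\<pi>' i)) \<in> carrier G2"
    using monoid.m_closed[OF group.is_monoid[OF group_G2] assms(1,2)] eq by simp
qed

section \<open>Evaluation of words in the moves\<close>

text \<open>The law of \<open>compose_wreath\<close> on tables, with twists reduced modulo 3. The
  right factor acts first, so words are read from right to left.\<close>

fun table_mult :: "move_table \<Rightarrow> move_table \<Rightarrow> move_table" where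
  "table_mult (ps, ts) (qs, us) = (map ((!) ps) qs, map2 (\<lambda>q u. (u + ts ! q) mod 3) qs us)"

fun table_word :: "move_table list \<Rightarrow> move_table" where
  "table_word [] = ([0, 1, 2, 3, 4, 5, 6, 7], [0, 0, 0, 0, 0, 0, 0, 0])"
| "table_word (x # xs) = table_mult x (table_word xs)"

lemma table_word_in_G2:
  assumes "set xs \<subseteq> {tab_u, tab_d, tab_f, tab_b, tab_l, tab_r}"
  shows "wreath_table (table_word xs) \<in> carrier G2"
proof -
  \<comment> \<open>The lengths and the range are carried along because the product of tables
    indexes one list by the entries of another.\<close>
  have "wreath_table (table_word xs) \<in> carrier G2 \<and> length (fst (table_word xs)) = 8
        \<and> length (snd (table_word xs)) = 8 \<and> set (fst (table_word xs)) \<subseteq> {..<8}"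
    using assms
  proof (induction xs)
    case Nil
    have "\<forall>i<8. [0, 1, 2, 3, 4, 5, 6, 7] ! i = i" "\<forall>i<8. [0, 0, 0, 0, 0, 0, 0, 0] ! i = (0 :: nat)"
      by (simp_all add: all_less_8)
    then have "wreath_table (table_word []) = \<one>\<^bsub>G2\<^esub>"
      unfolding one_G2 wreath_table_def by (intro wreath_cong) simp_all
    then show ?case
      using monoid.one_closed[OF group.is_monoid[OF group_G2]] by simp
  next
    case (Cons x xs)
    obtain ps ts where x_eq: "x = (ps, ts)"
      by fastforce
    obtain qs us where y_eq: "table_word xs = (qs, us)"
      by fastforce
    have x: "x \<in> {tab_u, tab_d, tab_f, tab_b, tab_l, tab_r}"
      and y: "wreath ((!) qs) ((!) us) \<in> carrier G2" "length qs = 8" "length us = 8" "set qs \<subseteq> {..<8}"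
      using Cons by (auto simp: y_eq wreath_table_def)
    have ps: "length ps = 8" "set ps = {..<8}"
      using tables_bij[OF x] by (simp_all add: x_eq)
    have "wreath_table x \<in> {move_u, move_d, move_f, move_b, move_l, move_r}"
      using x unfolding move_tables by blast
    then have "wreath_table x \<in> carrier G2"
      unfolding carrier_G2 by (rule generate.incl)
    then have "wreath ((!) ps \<circ> (!) qs) (\<lambda>i. us ! i + ts ! (qs ! i)) \<in> carrier G2"
      using y unfolding wreath_table_def x_eq fst_conv snd_conv
      by (intro wreath_mult_G2(2)) (metis lessThan_iff nth_mem subsetD)+
    also have "wreath ((!) ps \<circ> (!) qs) (\<lambda>i. us ! i + ts ! (qs ! i)) = wreath_table (table_word (x # xs))"
      unfolding wreath_table_def by (rule wreath_cong) (simp_all add: x_eq y_eq y)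
    finally show ?case
      using y ps nth_mem[of _ ps] by (auto simp: x_eq y_eq)
  qed
  then show ?thesis
    by blast
qed

text \<open>The words induce the transpositions of corner 0 with each other corner; their twists are
  left open. The last two are conjugates of the fourth by \<open>u\<close> and by
  \<open>u u\<close>, since \<open>u\<close> takes corner 4 to 6 and corner 6 to 7.\<close>

lemma transposition_words:
  "fst (table_word [tab_b, tab_d, tab_l, tab_f, tab_u]) = [1, 0, 2, 3, 4, 5, 6, 7]"
  "fst (table_word [tab_r, tab_d, tab_b, tab_l, tab_u]) = [2, 1, 0, 3, 4, 5, 6, 7]"
  "fst (table_word [tab_r, tab_r, tab_b, tab_d, tab_d, tab_l, tab_f, tab_f, tab_u]) = [3, 1, 2, 0, 4, 5, 6, 7]"
  "fst (table_word [tab_r, tab_b, tab_l, tab_u, tab_f]) = [4, 1, 2, 3, 0, 5, 6, 7]"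
  "fst (table_word [tab_l, tab_b, tab_l, tab_d, tab_f, tab_d, tab_f, tab_u, tab_u]) = [5, 1, 2, 3, 4, 0, 6, 7]"
  "fst (table_word [tab_u, tab_r, tab_b, tab_l, tab_u, tab_f, tab_u, tab_u, tab_u]) = [6, 1, 2, 3, 4, 5, 0, 7]"
  "fst (table_word [tab_u, tab_u, tab_r, tab_b, tab_l, tab_u, tab_f, tab_u, tab_u]) = [7, 1, 2, 3, 4, 5, 6, 0]"
  by code_simp+

text \<open>The word \<open>u u d l\<close> fixes the position of corner 0 and permutes the other seven cyclically, so its
  seventh power is a pure twist that is constant on those seven corners.\<close>

lemma twist_word:
  "table_word (concat (replicate 7 [tab_u, tab_u, tab_d, tab_l]))
   = ([0, 1, 2, 3, 4, 5, 6, 7], [2, 1, 1, 1, 1, 1, 1, 1])"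
  by code_simp

section \<open>Every permutation of the corners is induced by the group\<close>

definition realised :: "(nat \<Rightarrow> nat) \<Rightarrow> bool" where
  "realised \<pi> \<longleftrightarrow> (\<exists>\<tau>. wreath \<pi> \<tau> \<in> carrier G2)"

lemma realised_compose:
  assumes "realised \<pi>" "realised \<pi>'" "\<And>i. i < 8 \<Longrightarrow> \<pi>' i < 8"
  shows "realised (\<pi> \<circ> \<pi>')"
  using assms wreath_mult_G2(2) unfolding realised_def by meson

lemma realised_tableI:
  assumes "set xs \<subseteq> {tab_u, tab_d, tab_f, tab_b, tab_l, tab_r}" "fst (table_word xs) = ps"
    and "\<forall>i<8. ps ! i = \<pi> i"
  shows "realised \<pi>"
proof -
  have "wreath_table (table_word xs) = wreath \<pi> ((!) (snd (table_word xs)))"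
    unfolding wreath_table_def by (rule wreath_cong) (simp_all add: assms)
  then show ?thesis
    using table_word_in_G2[OF assms(1)] unfolding realised_def by metis
qed

lemma realised_transpose_0:
  assumes "i < 8"
  shows "realised (transpose 0 i)"
proof -
  have "i \<in> {0, 1, 2, 3, 4, 5, 6, 7}"
    using assms by auto
  moreover have "realised (transpose 0 0)"
    by (rule realised_tableI[OF _ refl, of "[]"]) (simp_all add: all_less_8)
  moreover have "realised (transpose 0 1)" "realised (transpose 0 2)" "realised (transpose 0 3)" "realised (transpose 0 4)"
      "realised (transpose 0 5)" "realised (transpose 0 6)" "realised (transpose 0 7)"
    by (rule realised_tableI[OF _ transposition_words(1)] realised_tableI[OF _ transposition_words(2)]
          realised_tableI[OF _ transposition_words(3)] realised_tableI[OF _ transposition_words(4)]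
          realised_tableI[OF _ transposition_words(5)] realised_tableI[OF _ transposition_words(6)]
          realised_tableI[OF _ transposition_words(7)];
        simp add: all_less_8 transpose_def)+
  ultimately show ?thesis
    by auto
qed

text \<open>Permutations are products of transpositions, and every transposition is obtained from
  those involving corner 0.\<close>

lemma realised_permutes:
  assumes "\<pi> permutes {..<8}"
  shows "realised \<pi>"
  using assms finite_lessThan
proof (induction rule: permutes_induct)
  case id
  show ?case
    using realised_transpose_0[of 0] by (simp add: id_def)
next
  case (swap a b p)
  note ab = \<open>a \<in> {..<8}\<close> \<open>b \<in> {..<8}\<close> \<open>a \<noteq> b\<close>
  have lt: "p i < 8" if "i < 8" for i
    using permutes_in_image[OF \<open>p permutes {..<8}\<close>] that by simp
  have lt_0: "transpose 0 a i < 8" "transpose 0 b i < 8" if "i < 8" for i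
    using ab that by (auto simp: transpose_def)
  have "realised (transpose a b)"
  proof (cases "a = 0 \<or> b = 0")
    case True
    then show ?thesis
      using realised_transpose_0 ab(1,2) transpose_commute by (metis lessThan_iff)
  next
    case False
    \<comment> \<open>Conjugating \<open>transpose 0 b\<close> by \<open>transpose 0 a\<close>
      replaces 0 by \<open>a\<close>.\<close>
    then have "transpose a b = transpose 0 a \<circ> transpose 0 b \<circ> transpose 0 a"
      using ab(3) by (auto simp: transpose_def fun_eq_iff)
    then show ?thesis
      using realised_transpose_0 ab(1,2) lt_0 by (auto intro!: realised_compose)
  qed
  then show ?case
    using \<open>realised p\<close> lt by (rule realised_compose)
qed

text \<open>Modulo 3, the twist vectors of these elements are the projections of the unit vectors onto the
  vectors of sum 0 along \<open>(1, \<dots>, 1)\<close>. They are permuted by \<^const>\<open>G2\<close> like the corners, and their product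
  is trivial.\<close>

definition corner_twist :: "nat \<Rightarrow> sticker \<Rightarrow> sticker" where
  "corner_twist i = wreath id (\<lambda>j. if j = i then 2 else 1)"

text \<open>Both sides move the corners by \<open>\<pi>\<close>. The exceptional corner is
  \<open>j = i\<close> on the left and \<open>\<pi> j = \<pi> i\<close> on the right, which agree by
  injectivity.\<close>

lemma wreath_corner_twist:
  assumes "bij_betw \<pi> {..<8} {..<8}" "i < 8"
  shows "compose stickers (wreath \<pi> \<tau>) (corner_twist i) = compose stickers (corner_twist (\<pi> i)) (wreath \<pi> \<tau>)"
proof -
  have "\<pi> j < 8" if "j < 8" for j
    using assms(1) that by (auto simp: bij_betw_def)
  moreover have "\<pi> j = \<pi> i \<longleftrightarrow> j = i" if "j < 8" for j
    using assms that by (auto simp: bij_betw_def inj_on_def)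
  ultimately show ?thesis
    unfolding corner_twist_def by (simp add: compose_wreath) (auto intro!: wreath_cong simp: add.commute)
qed

text \<open>Corner 0 is settled by the word of \<open>twist_word\<close>, and the others follow by
  conjugating with an element that exchanges corners 0 and \<open>i\<close>.\<close>

lemma corner_twist_in_G2:
  assumes "i < 8"
  shows "corner_twist i \<in> carrier G2"
proof -
  interpret group G2 by (rule group_G2)
  have "corner_twist 0 = wreath_table (table_word (concat (replicate 7 [tab_u, tab_u, tab_d, tab_l])))"
  proof -
    have "\<forall>i<8. [0, 1, 2, 3, 4, 5, 6, 7] ! i = i" "\<forall>i<8. [2, 1, 1, 1, 1, 1, 1, 1] ! i = (if i = 0 then 2 else 1 :: nat)"
      by (simp_all add: all_less_8)
    then show ?thesis
      unfolding twist_word wreath_table_def corner_twist_def by (intro wreath_cong) simp_all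
  qed
  then have 0: "corner_twist 0 \<in> carrier G2"
    using table_word_in_G2 by simp
  have t: "transpose 0 i permutes {..<8}"
    using assms by (simp add: permutes_swap_id)
  then obtain \<tau> where g: "wreath (transpose 0 i) \<tau> \<in> carrier G2" (is "?g \<in> _")
    using realised_permutes realised_def by blast
  \<comment> \<open>The conjugation takes place in the full bijection group, where
    \<open>corner_twist i\<close> is known to lie; its membership in \<open>G2\<close> is the
    goal.\<close>
  have T: "corner_twist i \<in> Bij stickers"
    unfolding corner_twist_def by (rule wreath_in_Bij) simp
  then have T': "corner_twist i \<in> carrier (BijGroup stickers)" by (simp add: BijGroup_def)
  have "compose stickers ?g (corner_twist 0) = compose stickers (corner_twist i) ?g"
    using wreath_corner_twist[OF permutes_imp_bij[OF t], of 0] by simp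
  then have e: "?g \<otimes>\<^bsub>BijGroup stickers\<^esub> corner_twist 0 = corner_twist i \<otimes>\<^bsub>BijGroup stickers\<^esub> ?g"
    using T g 0 G2_subset_Bij by (auto simp: BijGroup_def)
  have "corner_twist i = (?g \<otimes>\<^bsub>BijGroup stickers\<^esub> corner_twist 0) \<otimes>\<^bsub>BijGroup stickers\<^esub> inv\<^bsub>BijGroup stickers\<^esub> ?g"
    unfolding e using g G2_subset_Bij T'
    by (subst group.inv_solve_right[OF group_BijGroup])
       (auto simp: BijGroup_def compose_Bij)
  moreover have "?g \<otimes>\<^bsub>BijGroup stickers\<^esub> corner_twist 0 \<otimes>\<^bsub>BijGroup stickers\<^esub> inv\<^bsub>BijGroup stickers\<^esub> ?g \<in> carrier G2"
    using g 0 group.generate_is_subgroup[OF group_BijGroup moves_in_Bij] unfolding carrier_G2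
    by (simp add: subgroup.m_closed subgroup.m_inv_closed)
  ultimately show ?thesis
    by simp
qed

lemma corner_twist_mult:
  assumes "i < 8" "j < 8"
  shows "corner_twist i \<otimes>\<^bsub>G2\<^esub> corner_twist j
    = wreath id (\<lambda>k. (if k = j then 2 else 1) + (if k = i then 2 else 1))"
  using assms corner_twist_in_G2 wreath_mult_G2(1) unfolding corner_twist_def by simp

lemma corner_twist_commute:
  assumes "i < 8" "j < 8"
  shows "corner_twist i \<otimes>\<^bsub>G2\<^esub> corner_twist j = corner_twist j \<otimes>\<^bsub>G2\<^esub> corner_twist i"
  using assms by (simp add: corner_twist_mult add.commute)

lemma corner_twist_cube:
  assumes "i < 8"
  shows "corner_twist i \<otimes>\<^bsub>G2\<^esub> corner_twist i \<otimes>\<^bsub>G2\<^esub> corner_twist i = \<one>\<^bsub>G2\<^esub>"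
proof -
  have "wreath id (\<lambda>k. (if k = i then 2 else 1) + (if k = i then 2 else 1)) \<in> carrier G2"
    using monoid.m_closed[OF group.is_monoid[OF group_G2] corner_twist_in_G2[OF assms] corner_twist_in_G2[OF assms]]
    by (simp only: corner_twist_mult[OF assms assms])
  then show ?thesis
    using corner_twist_in_G2[OF assms] unfolding corner_twist_mult[OF assms assms] one_G2
    unfolding corner_twist_def
    by (subst wreath_mult_G2(1)) (auto intro: wreath_cong)
qed

lemma corner_twist_neq_one:
  assumes "i < 8"
  shows "corner_twist i \<noteq> \<one>\<^bsub>G2\<^esub>"
proof
  assume "corner_twist i = \<one>\<^bsub>G2\<^esub>"
  \<comment> \<open>The horizontal sticker at corner \<open>i\<close> is sent to index 2 by the
    twist but to index 0 by the identity.\<close>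
  then have "twist_of (corner_twist i (sticker_at i 0)) = twist_of (\<one>\<^bsub>G2\<^esub> (sticker_at i 0))"
    by simp
  then show False
    using assms unfolding corner_twist_def one_G2 by (simp add: wreath_sticker_at)
qed

lemma ex_conjugator:
  assumes "\<pi> permutes {..<8}"
  obtains g where "g \<in> carrier G2"
    "\<And>i. i < 8 \<Longrightarrow> g \<otimes>\<^bsub>G2\<^esub> corner_twist i = corner_twist (\<pi> i) \<otimes>\<^bsub>G2\<^esub> g"
proof -
  obtain \<tau> where g: "wreath \<pi> \<tau> \<in> carrier G2"
    using realised_permutes[OF assms] unfolding realised_def by blast
  have "wreath \<pi> \<tau> \<otimes>\<^bsub>G2\<^esub> corner_twist i = corner_twist (\<pi> i) \<otimes>\<^bsub>G2\<^esub> wreath \<pi> \<tau>" if i: "i < 8" for i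
  proof -
    have "\<pi> i < 8"
      using permutes_in_image[OF assms] i by simp
    then show ?thesis
      using g i corner_twist_in_G2 wreath_corner_twist[OF permutes_imp_bij[OF assms] i] by (simp add: mult_G2)
  qed
  then show thesis
    using that g by blast
qed

text \<open>The product of \<open>corner_twist 0\<close> to \<open>corner_twist (m - 1)\<close>:
  corner \<open>j\<close> receives 1 from each factor and one more from its own. For
  \<open>m = 8\<close> every entry is 9, so the product is trivial, which forces the joint
  eigenvalues to multiply to 1.\<close>

definition partial_twist :: "nat \<Rightarrow> sticker \<Rightarrow> sticker" where
  "partial_twist m = wreath id (\<lambda>j. if j < m then m + 1 else m)"

lemma partial_twist_Suc:
  assumes "partial_twist m \<in> carrier G2" "m < 8"
  shows "partial_twist (Suc m) = partial_twist m \<otimes>\<^bsub>G2\<^esub> corner_twist m"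
  using assms corner_twist_in_G2[OF assms(2)] unfolding partial_twist_def corner_twist_def
  by (subst wreath_mult_G2(1)) (auto intro!: wreath_cong)

lemma partial_twist_0: "partial_twist 0 = \<one>\<^bsub>G2\<^esub>"
  by (simp add: partial_twist_def one_G2)

lemma partial_twist_8: "partial_twist 8 = \<one>\<^bsub>G2\<^esub>"
  unfolding partial_twist_def one_G2 by (rule wreath_cong) auto

lemma partial_twist_in_G2: "m \<le> 8 \<Longrightarrow> partial_twist m \<in> carrier G2"
proof (induction m)
  case 0
  show ?case
    unfolding partial_twist_0 by (rule monoid.one_closed[OF group.is_monoid[OF group_G2]])
next
  case (Suc m)
  then have "partial_twist m \<in> carrier G2" "m < 8"
    by auto
  then show ?case
    using monoid.m_closed[OF group.is_monoid[OF group_G2]] corner_twist_in_G2 by (simp add: partial_twist_Suc)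
qed

section \<open>Lower bounds\<close>

text \<open>The definition demands only multiplicativity and invertibility; an invertible idempotent
  matrix is the identity.\<close>

lemma faithful_rep_one:
  assumes "group G" "faithful_rep G n \<rho>"
  shows "\<rho> \<one>\<^bsub>G\<^esub> = 1\<^sub>m n"
proof -
  interpret group G by fact
  let ?E = "\<rho> \<one>\<^bsub>G\<^esub>"
  have E: "?E \<in> carrier_mat n n" "invertible_mat ?E" and idem: "?E * ?E = ?E"
    using assms(2) unfolding faithful_rep_def by (auto simp flip: r_one) (metis one_closed r_one)+
  obtain B where B: "?E * B = 1\<^sub>m n" "B * ?E = 1\<^sub>m (dim_row B)"
    using E unfolding invertible_mat_def inverts_mat_def by auto
  have "dim_col B = n" "dim_row B = n"
    using arg_cong[OF B(1), of dim_col] arg_cong[OF B(2), of dim_col] E(1) by auto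
  then have "B \<in> carrier_mat n n"
    by auto
  then have "B * (?E * ?E) = ?E"
    using E(1) B(2) by (simp flip: assoc_mult_mat[of _ n n _ n _ n])
  then show ?thesis
    using idem B(2) \<open>dim_row B = n\<close> by simp
qed

lemma faithful_repI:
  assumes "group G" and one: "\<rho> \<one>\<^bsub>G\<^esub> = 1\<^sub>m n"
    and carr: "\<And>g. g \<in> carrier G \<Longrightarrow> \<rho> g \<in> carrier_mat n n"
    and mult: "\<And>g h. g \<in> carrier G \<Longrightarrow> h \<in> carrier G \<Longrightarrow> \<rho> (g \<otimes>\<^bsub>G\<^esub> h) = \<rho> g * \<rho> h"
    and inj: "inj_on \<rho> (carrier G)"
  shows "faithful_rep G n \<rho>"
proof -
  interpret group G by fact
  have "invertible_mat (\<rho> g)" if g: "g \<in> carrier G" for g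
    unfolding invertible_mat_def inverts_mat_def
  proof (intro conjI exI)
    show "square_mat (\<rho> g)"
      using carr[OF g] by auto
    show "\<rho> g * \<rho> (inv\<^bsub>G\<^esub> g) = 1\<^sub>m (dim_row (\<rho> g))"
      using mult[of g "inv\<^bsub>G\<^esub> g"] carr[OF g] g one by auto
    show "\<rho> (inv\<^bsub>G\<^esub> g) * \<rho> g = 1\<^sub>m (dim_row (\<rho> (inv\<^bsub>G\<^esub> g)))"
      using mult[of "inv\<^bsub>G\<^esub> g" g] carr[of "inv\<^bsub>G\<^esub> g"] g one by auto
  qed
  then show ?thesis
    unfolding faithful_rep_def using carr mult inj by blast
qed

text \<open>Gathers what both dimension bounds need: a set of at most \<open>n\<close> functions,
  stable under permutations, with a nonconstant member whose values are cube roots of unity of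
  product 1.\<close>

lemma corner_twist_joint_spectrum:
  fixes \<rho> :: "(sticker \<Rightarrow> sticker) \<Rightarrow> complex mat"
  assumes \<rho>: "faithful_rep G2 n \<rho>"
  defines "L \<equiv> joint_spectrum n 8 (\<lambda>i. \<rho> (corner_twist i))"
  shows "finite L" "card L \<le> n"
    and "permutation_closed 8 L"
    and "\<exists>e\<in>L. (\<exists>i<8. \<exists>j<8. e i \<noteq> e j) \<and> (\<forall>i<8. e i ^ 3 = 1) \<and> (\<Prod>i<8. e i) = 1"
proof -
  interpret group G2 by (rule group_G2)
  have carr: "\<rho> g \<in> carrier_mat n n" if "g \<in> carrier G2" for g
    using \<rho> that unfolding faithful_rep_def by blast
  have mult: "\<rho> (g \<otimes>\<^bsub>G2\<^esub> h) = \<rho> g * \<rho> h" if "g \<in> carrier G2" "h \<in> carrier G2" for g h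
    using \<rho> that unfolding faithful_rep_def by blast
  have rho_one: "\<rho> \<one>\<^bsub>G2\<^esub> = 1\<^sub>m n"
    using faithful_rep_one[OF group_G2 \<rho>] .
  note T = corner_twist_in_G2
  have act: "\<rho> (g \<otimes>\<^bsub>G2\<^esub> h) *\<^sub>v v = \<rho> g *\<^sub>v (\<rho> h *\<^sub>v v)"
    if "g \<in> carrier G2" "h \<in> carrier G2" "v \<in> carrier_vec n" for g h v
    unfolding mult[OF that(1,2)] by (rule assoc_mult_mat_vec[OF carr[OF that(1)] carr[OF that(2)] that(3)])
  show "finite L" "card L \<le> n"
    unfolding L_def by (rule card_joint_spectrum[OF carr[OF T]]; assumption)+
  have "(\<lambda>i\<in>{..<8}. e (\<pi> i)) \<in> L" if e: "e \<in> L" and \<pi>: "\<pi> permutes {..<8}" for e \<pi>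
  proof -
    obtain v where v: "v \<in> carrier_vec n" "v \<noteq> 0\<^sub>v n"
        "\<And>i. i < 8 \<Longrightarrow> \<rho> (corner_twist i) *\<^sub>v v = e i \<cdot>\<^sub>v v"
      using e unfolding L_def joint_spectrum_def by blast
    \<comment> \<open>The inverse permutation is used so that moving a twist past \<open>g\<close>
      turns index \<open>i\<close> into \<open>\<pi> i\<close>, the index at which \<open>e\<close>
      is to be read.\<close>
    obtain g where g: "g \<in> carrier G2" "\<And>i. i < 8 \<Longrightarrow> g \<otimes>\<^bsub>G2\<^esub> corner_twist i
        = corner_twist (inv_into UNIV \<pi> i) \<otimes>\<^bsub>G2\<^esub> g"
      using ex_conjugator[OF permutes_inv[OF \<pi>]] by blast
    let ?w = "\<rho> g *\<^sub>v v"
    have w: "?w \<in> carrier_vec n"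
      using carr[OF g(1)] v(1) by simp
    \<comment> \<open>\<open>\<rho> g\<close> is undone by the inverse of \<open>g\<close>, so the
      transported vector is nonzero.\<close>
    have "\<rho> (inv\<^bsub>G2\<^esub> g) *\<^sub>v ?w = v"
      using act[of "inv\<^bsub>G2\<^esub> g" g v] g(1) v(1) rho_one by simp
    moreover have "\<rho> (inv\<^bsub>G2\<^esub> g) *\<^sub>v 0\<^sub>v n = 0\<^sub>v n"
      using carr[OF inv_closed[OF g(1)]] by (intro eq_vecI) auto
    ultimately have "?w \<noteq> 0\<^sub>v n"
      using v(2) by metis
    moreover have "\<rho> (corner_twist i) *\<^sub>v ?w = e (\<pi> i) \<cdot>\<^sub>v ?w" if i: "i < 8" for i
    proof -
      have \<pi>i: "\<pi> i < 8"
        using permutes_in_image[OF \<pi>] i by simp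
      have "\<rho> (corner_twist i) *\<^sub>v ?w = \<rho> (corner_twist i \<otimes>\<^bsub>G2\<^esub> g) *\<^sub>v v"
        using act T[OF i] g(1) v(1) by simp
      also have "corner_twist i \<otimes>\<^bsub>G2\<^esub> g = g \<otimes>\<^bsub>G2\<^esub> corner_twist (\<pi> i)"
        using g(2)[OF \<pi>i] permutes_inverses(2)[OF \<pi>] by simp
      also have "\<rho> (g \<otimes>\<^bsub>G2\<^esub> corner_twist (\<pi> i)) *\<^sub>v v = \<rho> g *\<^sub>v (e (\<pi> i) \<cdot>\<^sub>v v)"
        using act T[OF \<pi>i] g(1) v(1) v(3)[OF \<pi>i] by simp
      also have "\<dots> = e (\<pi> i) \<cdot>\<^sub>v ?w"
        by (rule mult_mat_vec[OF carr[OF g(1)] v(1)])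
      finally show ?thesis .
    qed
    ultimately show ?thesis
      using w unfolding L_def joint_spectrum_def by (auto intro!: bexI[of _ ?w])
  qed
  then show "permutation_closed 8 L"
    unfolding permutation_closed_def by blast
  have neq: "\<rho> (corner_twist 0) \<noteq> 1\<^sub>m n"
    using \<rho> corner_twist_neq_one[of 0] T[of 0] rho_one unfolding faithful_rep_def inj_on_def by force
  have cube: "\<rho> (corner_twist i) * \<rho> (corner_twist i) * \<rho> (corner_twist i) = 1\<^sub>m n" if "i < 8" for i
  proof -
    have "\<rho> (corner_twist i \<otimes>\<^bsub>G2\<^esub> corner_twist i \<otimes>\<^bsub>G2\<^esub> corner_twist i)
        = \<rho> (corner_twist i) * \<rho> (corner_twist i) * \<rho> (corner_twist i)"
      by (simp only: mult m_closed T[OF that])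
    then show ?thesis
      unfolding corner_twist_cube[OF that] rho_one by (rule sym)
  qed
  have comm: "\<rho> (corner_twist i) * \<rho> (corner_twist j) = \<rho> (corner_twist j) * \<rho> (corner_twist i)"
    if "i < 8" "j < 8" for i j
    using corner_twist_commute[OF that] mult[OF T[OF that(1)] T[OF that(2)]] mult[OF T[OF that(2)] T[OF that(1)]]
    by simp
  obtain e where e: "e \<in> L" "e 0 \<noteq> 1"
    unfolding L_def
    using joint_spectrum_nontrivial[of 8 "\<lambda>i. \<rho> (corner_twist i)" n 0, OF carr[OF T] cube comm] neq by auto
  have e3: "e i ^ 3 = 1" if "i < 8" for i
    using joint_spectrum_cube[of "\<lambda>i. \<rho> (corner_twist i)" i n e 8] carr[OF T[OF that]] cube[OF that] e(1) that
    unfolding L_def by blast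
  obtain v where v: "v \<in> carrier_vec n" "v \<noteq> 0\<^sub>v n"
      "\<And>i. i < 8 \<Longrightarrow> \<rho> (corner_twist i) *\<^sub>v v = e i \<cdot>\<^sub>v v"
    using e(1) unfolding L_def joint_spectrum_def by blast
  \<comment> \<open>The partial products of the eigenvalues are eigenvalues of the partial twists.
    At \<open>m = 8\<close> the twist is the identity.\<close>
  have "\<rho> (partial_twist m) *\<^sub>v v = (\<Prod>i<m. e i) \<cdot>\<^sub>v v" if "m \<le> 8" for m
    using that
  proof (induction m)
    case 0
    then show ?case
      using v(1) rho_one partial_twist_0 by simp
  next
    case (Suc m)
    then have m: "m < 8" "m \<le> 8"
      by auto
    have "\<rho> (partial_twist (Suc m)) *\<^sub>v v = \<rho> (partial_twist m) *\<^sub>v (e m \<cdot>\<^sub>v v)"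
      using partial_twist_Suc[OF partial_twist_in_G2[OF m(2)] m(1)] v(1) v(3)[OF m(1)]
      by (simp add: act partial_twist_in_G2[OF m(2)] T[OF m(1)])
    also have "\<dots> = e m \<cdot>\<^sub>v (\<rho> (partial_twist m) *\<^sub>v v)"
      by (rule mult_mat_vec[OF carr[OF partial_twist_in_G2[OF m(2)]] v(1)])
    finally show ?case
      using Suc.IH[OF m(2)] by (simp add: smult_smult_assoc mult.commute)
  qed
  from this[of 8] have "1 \<cdot>\<^sub>v v = (\<Prod>i<8. e i) \<cdot>\<^sub>v v"
    using v(1) rho_one partial_twist_8 by simp
  then have prod: "(\<Prod>i<8. e i) = 1"
    using smult_vec_right_cancel[OF _ v(1,2)] by metis
  have "\<exists>i<8. \<exists>j<8. e i \<noteq> e j"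
  proof (rule ccontr)
    assume "\<not> (\<exists>i<8. \<exists>j<8. e i \<noteq> e j)"
    then have const: "e i = e 0" if "i \<in> {..<8}" for i
      using that by (metis lessThan_iff zero_less_numeral)
    have "(\<Prod>i<8. e i) = (\<Prod>i<8 :: nat. e 0)"
      by (rule prod.cong[OF refl const])
    then have "e 0 ^ 8 = 1"
      using prod by simp
    \<comment> \<open>A constant value would have eighth power 1 by the product and ninth power 1 as
      a cube root of unity, hence be 1 itself.\<close>
    moreover have "e 0 ^ 8 * e 0 = (e 0 ^ 3) ^ 3"
      by (simp flip: power_mult power_Suc2)
    ultimately show False
      using e(2) e3[of 0] by simp
  qed
  then show "\<exists>e\<in>L. (\<exists>i<8. \<exists>j<8. e i \<noteq> e j) \<and> (\<forall>i<8. e i ^ 3 = 1) \<and> (\<Prod>i<8. e i) = 1"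
    using e(1) e3 prod by blast
qed

lemma complex_dim_ge_8:
  fixes \<rho> :: "(sticker \<Rightarrow> sticker) \<Rightarrow> complex mat"
  assumes "faithful_rep G2 n \<rho>"
  shows "8 \<le> n"
proof -
  note L = corner_twist_joint_spectrum[OF assms]
  obtain e i j where "e \<in> joint_spectrum n 8 (\<lambda>i. \<rho> (corner_twist i))" "i < 8" "j < 8" "e i \<noteq> e j"
    using L(4) by blast
  then have "8 \<le> card (joint_spectrum n 8 (\<lambda>i. \<rho> (corner_twist i)))"
    by (rule card_ge_8[OF L(1,3)])
  then show ?thesis
    using L(2) by simp
qed

text \<open>Extension of scalars makes complex joint eigenvalues available for a real
  representation. It stays faithful because entrywise real parts recover the matrix.\<close>

lemma faithful_rep_of_real:
  assumes "group G" "faithful_rep G n (\<rho> :: _ \<Rightarrow> real mat)"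
  shows "faithful_rep G n (\<lambda>g. map_mat complex_of_real (\<rho> g))"
proof (rule faithful_repI[OF assms(1)])
  have \<rho>: "\<rho> g \<in> carrier_mat n n" "h \<in> carrier G \<Longrightarrow> \<rho> (g \<otimes>\<^bsub>G\<^esub> h) = \<rho> g * \<rho> h" "inj_on \<rho> (carrier G)"
    if "g \<in> carrier G" for g h
    using assms(2) that unfolding faithful_rep_def by blast+
  show "map_mat complex_of_real (\<rho> \<one>\<^bsub>G\<^esub>) = 1\<^sub>m n"
    using faithful_rep_one[OF assms] by (simp add: of_real_hom.mat_hom_one)
  show "map_mat complex_of_real (\<rho> g) \<in> carrier_mat n n" if "g \<in> carrier G" for g
    using \<rho>(1)[OF that] by simp
  show "map_mat complex_of_real (\<rho> (g \<otimes>\<^bsub>G\<^esub> h)) = map_mat complex_of_real (\<rho> g) * map_mat complex_of_real (\<rho> h)"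
    if "g \<in> carrier G" "h \<in> carrier G" for g h
    unfolding \<rho>(2)[OF that] by (rule of_real_hom.mat_hom_mult[OF \<rho>(1)[OF that(1)] \<rho>(1)[OF that(2)]])
  show "inj_on (\<lambda>g. map_mat complex_of_real (\<rho> g)) (carrier G)"
  proof (rule inj_onI)
    fix g h
    assume g: "g \<in> carrier G" and h: "h \<in> carrier G"
      and eq: "map_mat complex_of_real (\<rho> g) = map_mat complex_of_real (\<rho> h)"
    have "\<rho> g = map_mat Re (map_mat complex_of_real (\<rho> g))" "\<rho> h = map_mat Re (map_mat complex_of_real (\<rho> h))"
      by (auto intro!: eq_matI)
    then have "\<rho> g = \<rho> h"
      using eq by simp
    then show "g = h"
      using \<rho>(3)[OF g] g h by (auto dest: inj_onD)
  qed
qed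

lemma real_dim_ge_16:
  fixes \<rho> :: "(sticker \<Rightarrow> sticker) \<Rightarrow> real mat"
  assumes "faithful_rep G2 n \<rho>"
  shows "16 \<le> n"
proof -
  let ?L = "joint_spectrum n 8 (\<lambda>i. map_mat complex_of_real (\<rho> (corner_twist i)))"
  note L = corner_twist_joint_spectrum[OF faithful_rep_of_real[OF group_G2 assms]]
  obtain e i j where e: "e \<in> ?L" "\<And>i. i < 8 \<Longrightarrow> e i ^ 3 = 1" "(\<Prod>i<8. e i) = 1"
      and ij: "i < 8" "j < 8" "e i \<noteq> e j"
    using L(4) by blast
  have carr: "\<rho> (corner_twist i) \<in> carrier_mat n n" if "i < 8" for i
    using assms corner_twist_in_G2[OF that] unfolding faithful_rep_def by blast
  have "16 \<le> card ?L"
    by (rule card_ge_16[OF L(1) L(3) joint_spectrum_cnj[OF carr] e ij])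
  then show ?thesis
    using L(2) by simp
qed

section \<open>The monomial representation and its restriction of scalars\<close>

text \<open>Column \<open>p\<close> follows the horizontal sticker of corner \<open>p\<close>: its
  row is the new corner, its entry records the twist. Reading both from \<open>g\<close> avoids
  choosing \<open>\<pi>\<close> and \<open>\<tau>\<close>.\<close>

definition monomial_rep :: "(sticker \<Rightarrow> sticker) \<Rightarrow> complex mat" where
  "monomial_rep g = mat 8 8 (\<lambda>(q, p). if corner_of (g (sticker_at p 0)) = q
     then omega ^ twist_of (g (sticker_at p 0)) else 0)"

lemma omega_power_mod: "omega ^ (k mod 3) = omega ^ k"
proof -
  have "omega ^ k = omega ^ (3 * (k div 3) + k mod 3)"
    by simp
  also have "\<dots> = omega ^ (k mod 3)"
    by (simp only: power_add power_mult omega_cube power_one mult_1)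
  finally show ?thesis
    by simp
qed

lemma omega_power_eq_iff: "omega ^ k = omega ^ l \<longleftrightarrow> k mod 3 = l mod 3"
proof
  assume "omega ^ k = omega ^ l"
  then have "omega ^ (k mod 3) = omega ^ (l mod 3)"
    by (simp add: omega_power_mod)
  moreover have "k mod 3 \<in> {0, 1, 2}" "l mod 3 \<in> {0, 1, 2}"
    by auto
  ultimately show "k mod 3 = l mod 3"
    using omega_neq omega_neq[symmetric] by auto
next
  assume "k mod 3 = l mod 3"
  then show "omega ^ k = omega ^ l"
    using omega_power_mod by metis
qed

lemma monomial_rep_wreath:
  assumes "\<And>p. p < 8 \<Longrightarrow> \<pi> p < 8"
  shows "monomial_rep (wreath \<pi> \<tau>) = mat 8 8 (\<lambda>(q, p). if \<pi> p = q then omega ^ \<tau> p else 0)"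
  unfolding monomial_rep_def
  by (rule eq_matI) (auto simp: wreath_sticker_at assms omega_power_mod)

text \<open>In each entry of the matrix product only the summand \<open>r = \<pi>' p\<close> can be
  nonzero, and multiplying powers of \<open>omega\<close> adds the twists.\<close>

lemma monomial_rep_mult:
  assumes \<pi>: "\<And>p. p < 8 \<Longrightarrow> \<pi> p < 8" and \<pi>': "\<And>p. p < 8 \<Longrightarrow> \<pi>' p < 8"
  shows "monomial_rep (wreath (\<pi> \<circ> \<pi>') (\<lambda>i. \<tau>' i + \<tau> (\<pi>' i)))
    = monomial_rep (wreath \<pi> \<tau>) * monomial_rep (wreath \<pi>' \<tau>')"
proof -
  have "(\<Sum>r = 0..<8. (if \<pi> r = q then omega ^ \<tau> r else 0) * (if \<pi>' p = r then omega ^ \<tau>' p else 0))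
      = (if \<pi> (\<pi>' p) = q then omega ^ (\<tau>' p + \<tau> (\<pi>' p)) else 0)" if "p < 8" for p q
  proof -
    have "(\<Sum>r = 0..<8. (if \<pi> r = q then omega ^ \<tau> r else 0) * (if \<pi>' p = r then omega ^ \<tau>' p else 0))
      = (\<Sum>r = 0..<8. if \<pi>' p = r then (if \<pi> r = q then omega ^ \<tau> r else 0) * omega ^ \<tau>' p else 0)"
      by (rule sum.cong) auto
    then show ?thesis
      using \<pi>'[OF that] by (simp add: power_add)
  qed
  then show ?thesis
    using \<pi> \<pi>' by (intro eq_matI) (simp_all add: monomial_rep_wreath scalar_prod_def)
qed

lemma faithful_monomial_rep: "faithful_rep G2 8 monomial_rep"
proof (rule faithful_repI[OF group_G2])
  show "monomial_rep \<one>\<^bsub>G2\<^esub> = 1\<^sub>m 8"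
    unfolding one_G2 by (subst monomial_rep_wreath) (auto intro!: eq_matI)
  show "monomial_rep g \<in> carrier_mat 8 8" if "g \<in> carrier G2" for g
    by (simp add: monomial_rep_def)
  fix g h
  assume gh: "g \<in> carrier G2" "h \<in> carrier G2"
  obtain \<pi> \<tau> where \<pi>: "bij_betw \<pi> {..<8} {..<8}" and g: "g = wreath \<pi> \<tau>"
    using gh(1) by (rule G2_wreath)
  obtain \<pi>' \<tau>' where \<pi>': "bij_betw \<pi>' {..<8} {..<8}" and h: "h = wreath \<pi>' \<tau>'"
    using gh(2) by (rule G2_wreath)
  have lt: "\<pi> p < 8" "\<pi>' p < 8" if "p < 8" for p
    using \<pi> \<pi>' that by (auto simp: bij_betw_def)
  show "monomial_rep (g \<otimes>\<^bsub>G2\<^esub> h) = monomial_rep g * monomial_rep h"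
    using gh lt unfolding g h by (simp add: wreath_mult_G2(1) monomial_rep_mult)
next
  show "inj_on monomial_rep (carrier G2)"
  proof (rule inj_onI)
    fix g h
    assume gh: "g \<in> carrier G2" "h \<in> carrier G2" and eq: "monomial_rep g = monomial_rep h"
    obtain \<pi> \<tau> where \<pi>: "bij_betw \<pi> {..<8} {..<8}" and g: "g = wreath \<pi> \<tau>"
      using gh(1) by (rule G2_wreath)
    obtain \<pi>' \<tau>' where \<pi>': "bij_betw \<pi>' {..<8} {..<8}" and h: "h = wreath \<pi>' \<tau>'"
      using gh(2) by (rule G2_wreath)
    have lt: "\<pi> p < 8" "\<pi>' p < 8" if "p < 8" for p
      using \<pi> \<pi>' that by (auto simp: bij_betw_def)
    have *: "\<pi>' p = \<pi> p \<and> omega ^ \<tau> p = omega ^ \<tau>' p" if p: "p < 8" for p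
    proof -
      \<comment> \<open>This entry is a nonzero power of \<open>omega\<close> for \<open>g\<close>,
        so the matrix of \<open>h\<close> has its nonzero entry of column \<open>p\<close> in the
        same row.\<close>
      have "monomial_rep g $$ (\<pi> p, p) = monomial_rep h $$ (\<pi> p, p)"
        using eq by simp
      then have "omega ^ \<tau> p = (if \<pi>' p = \<pi> p then omega ^ \<tau>' p else 0)"
        unfolding g h using lt p by (simp add: monomial_rep_wreath)
      moreover have "omega ^ \<tau> p \<noteq> 0"
        using omega_cube by auto
      ultimately show ?thesis
        by (auto split: if_splits)
    qed
    then show "g = h"
      unfolding g h by (intro wreath_cong) (simp_all add: omega_power_eq_iff)
  qed
qed

section \<open>Restriction of scalars\<close>

lemma realify_carrier: "A \<in> carrier_mat n n \<Longrightarrow> realify A \<in> carrier_mat (n + n) (n + n)"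
  by (simp add: realify_def)

lemma realify_mult:
  assumes "A \<in> carrier_mat n n" "B \<in> carrier_mat n n"
  shows "realify (A * B) = realify A * realify B"
proof -
  let ?R = "map_mat Re" and ?I = "map_mat Im" and ?J = "map_mat (\<lambda>z. - Im z)"
  have "realify A * realify B = four_block_mat (?R A * ?R B + ?J A * ?I B) (?R A * ?J B + ?J A * ?R B)
      (?I A * ?R B + ?R A * ?I B) (?I A * ?J B + ?R A * ?R B)"
    unfolding realify_def using assms by (intro mult_four_block_mat) auto
  \<comment> \<open>Real and imaginary parts of a complex product. The real part is given twice
    because the two diagonal blocks arise from different sums.\<close>
  moreover have "?R (A * B) = ?R A * ?R B + ?J A * ?I B" "?J (A * B) = ?R A * ?J B + ?J A * ?R B"
      "?I (A * B) = ?I A * ?R B + ?R A * ?I B" "?R (A * B) = ?I A * ?J B + ?R A * ?R B"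
    using assms by (auto simp: scalar_prod_def sum.distrib sum_subtractf sum_negf)
  ultimately show ?thesis
    unfolding realify_def by metis
qed

lemma realify_one: "realify (1\<^sub>m n) = 1\<^sub>m (n + n)"
proof -
  have "map_mat Re (1\<^sub>m n) = 1\<^sub>m n" "map_mat (\<lambda>z. - Im z) (1\<^sub>m n) = 0\<^sub>m n n" "map_mat Im (1\<^sub>m n) = 0\<^sub>m n n"
    by (auto intro!: eq_matI)
  then show ?thesis
    by (simp add: realify_def)
qed

lemma realify_inject:
  assumes "A \<in> carrier_mat n n" "B \<in> carrier_mat n n" "realify A = realify B"
  shows "A = B"
proof (rule eq_matI)
  fix i j
  assume "i < dim_row B" "j < dim_col B"
  then have ij: "i < n" "j < n"
    using assms(2) by auto
  \<comment> \<open>The left half of the block matrix already contains all real and imaginary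
    parts.\<close>
  have "realify A $$ (i, j) = realify B $$ (i, j)" "realify A $$ (n + i, j) = realify B $$ (n + i, j)"
    using assms(3) by auto
  then show "A $$ (i, j) = B $$ (i, j)"
    using assms(1,2) ij by (auto simp: realify_def complex_eq_iff)
qed (use assms in auto)

lemma faithful_rep_realify:
  assumes "group G" "faithful_rep G n \<rho>"
  shows "faithful_rep G (n + n) (\<lambda>g. realify (\<rho> g))"
proof (rule faithful_repI[OF assms(1)])
  have \<rho>: "\<rho> g \<in> carrier_mat n n" "h \<in> carrier G \<Longrightarrow> \<rho> (g \<otimes>\<^bsub>G\<^esub> h) = \<rho> g * \<rho> h" if "g \<in> carrier G" for g h
    using assms(2) that unfolding faithful_rep_def by blast+
  show "realify (\<rho> \<one>\<^bsub>G\<^esub>) = 1\<^sub>m (n + n)"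
    using faithful_rep_one[OF assms] by (simp add: realify_one)
  show "realify (\<rho> g) \<in> carrier_mat (n + n) (n + n)" if "g \<in> carrier G" for g
    using \<rho>(1)[OF that] by (rule realify_carrier)
  show "realify (\<rho> (g \<otimes>\<^bsub>G\<^esub> h)) = realify (\<rho> g) * realify (\<rho> h)" if "g \<in> carrier G" "h \<in> carrier G" for g h
    unfolding \<rho>(2)[OF that] by (rule realify_mult[OF \<rho>(1)[OF that(1)] \<rho>(1)[OF that(2)]])
  show "inj_on (\<lambda>g. realify (\<rho> g)) (carrier G)"
  proof (rule inj_onI)
    fix g h
    assume gh: "g \<in> carrier G" "h \<in> carrier G" and "realify (\<rho> g) = realify (\<rho> h)"
    then have "\<rho> g = \<rho> h"
      using \<rho>(1) realify_inject by blast
    then show "g = h"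
      using assms(2) gh unfolding faithful_rep_def by (auto dest: inj_onD)
  qed
qed

theorem theorem5p1:
  shows "mdim TYPE(complex) G2 = 8 \<and> mdim TYPE(real) G2 = 16 \<and>
         (\<exists>\<rho> :: (sticker \<Rightarrow> sticker) \<Rightarrow> complex mat.
            faithful_rep G2 8 \<rho> \<and> faithful_rep G2 16 (\<lambda>g. realify (\<rho> g)))"
proof (intro conjI exI)
  show 8: "faithful_rep G2 8 monomial_rep"
    by (rule faithful_monomial_rep)
  show 16: "faithful_rep G2 16 (\<lambda>g. realify (monomial_rep g))"
    using faithful_rep_realify[OF group_G2 8] by simp
  show "mdim TYPE(complex) G2 = 8"
    unfolding mdim_def using 8 complex_dim_ge_8 by (intro Least_equality) blast+
  show "mdim TYPE(real) G2 = 16"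
    unfolding mdim_def using 16 real_dim_ge_16 by (intro Least_equality) blast+
qed

end
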